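(* There is a constant $C$, independent of $n$, of the time levels and of $u$, such that the following holds. For $1\le n\le N$, if $Au^{(r)}$ and $u^{(r+1)}$ are continuous on $\bar I_n=[t_{n-1},t_n]$ (as $\mathbb{L}$-valued functions), then $$\bigl\|U-u+a_{nr}(u)(p_{nr}-p_{n,r-1})\bigr\|_{I_n}\le C\|U^{n-1}_--u(t_{n-1})\|+Ck_n^{r+1}\bigl(\|Au^{(r)}\|_{I_n}+\|u^{(r+1)}\|_{I_n}\bigr).$$
   Context: Let $\mathbb{H}\subseteq\mathbb{L}$ be (real) Hilbert spaces with compact and dense imbedding; $\langle\cdot,\cdot\rangle$ and $\|\cdot\|$ are the inner product and norm of $\mathbb{L}$. Identifying $\mathbb{L}$ with its dual gives $\mathbb{H}\subseteq\mathbb{L}\subseteq\mathbb{H}^*$, and $\langle\cdot,\cdot\rangle$ also denotes the duality pairing. The linear operator $A:\mathbb{H}\to\mathbb{H}^*$ is bounded, self-adjoint and strictly positive-definite. The function $u$ is the solution of $u'(t)+Au(t)=f(t)$ for $0<t\le T$, $u(0)=u_0$; it is assumed that $u:[0,T]\to\mathbb{L}$ is continuous and $u(t)\in\mathbb{H}$ for $t>0$. Here $u^{(\ell)}$ is the $\ell$th derivative in $t$. Time levels: $0=t_0<t_1<\cdots<t_N=T$, $I_n=(t_{n-1},t_n)$, $k_n=t_n-t_{n-1}$. For a function $v$ on $I_n$, $\|v\|_{I_n}=\sup_{t\in I_n}\|v(t)\|$. Fix an integer $r\ge1$. $\mathcal{X}_r$ is the space of functions $X$ whose restriction to each $I_n$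 ($1\le n\le N$) is a polynomial in $t$ of degree at most $r-1$ with coefficients in $\mathbb{H}$ (no continuity required at the $t_n$); $X^n_\pm=\lim_{t\to t_n^\pm}X(t)$. The discontinuous Galerkin (DG) solution is the unique $U\in\mathcal{X}_r$ satisfying, with $U^0_-=u_0$, $$\langle U^{n-1}_+,X^{n-1}_+\rangle+\int_{I_n}\langle U'+AU,X\rangle\,dt=\langle U^{n-1}_-,X^{n-1}_+\rangle+\int_{I_n}\langle f,X\rangle\,dt$$ for all $X\in\mathcal{X}_r$ and $1\le n\le N$. $P_j$ is the Legendre polynomial of degree $j$ with $P_j(1)=1$; $p_{nj}(t)=P_j(\tau)$ for $t=\tfrac12[(1-\tau)t_{n-1}+(1+\tau)t_n]$, $-1\le\tau\le1$. The local Legendre coefficients of $v$ on $I_n$ are $a_{nj}(v)=\frac{2j+1}{k_n}\int_{I_n}v(t)p_{nj}(t)\,dt$. *)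

theory Defs
  imports "HOL-Analysis.Analysis" "HOL-Computational_Algebra.Polynomial"
begin

section \<open>The spaces and the operator\<close>

text \<open>
  The Hilbert spaces are types of the classes \<^class>\<open>real_inner\<close> and \<^class>\<open>banach\<close>.
  The inclusion of \<open>\<H>\<close> in \<open>\<L>\<close> is an explicit injection \<open>\<iota> :: 'h \<Rightarrow>\<^sub>L 'l\<close>, and the dual of \<open>\<H>\<close> is
  \<open>'h \<Rightarrow>\<^sub>L real\<close>. The duality pairing of \<open>\<phi>\<close> and \<open>x\<close> is the application of \<open>\<phi>\<close> to \<open>x\<close>.
\<close>

definition compact_dense_embedding :: "('h::{real_inner,banach} \<Rightarrow>\<^sub>L 'l::{real_inner,banach}) \<Rightarrow> bool"
  where "compact_dense_embedding \<iota> \<longleftrightarrow>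
    inj (blinfun_apply \<iota>) \<and>
    (\<forall>B. bounded B \<longrightarrow> compact (closure (blinfun_apply \<iota> ` B))) \<and>
    closure (range (blinfun_apply \<iota>)) = UNIV"

text \<open>The inclusion of \<open>\<L>\<close> in the dual of \<open>\<H>\<close>: it sends \<open>v\<close> to the functional mapping \<open>x\<close> to \<open>v \<bullet> \<iota> x\<close>.\<close>

definition L_to_dual :: "('h::{real_inner,banach} \<Rightarrow>\<^sub>L 'l::{real_inner,banach}) \<Rightarrow> 'l \<Rightarrow> ('h \<Rightarrow>\<^sub>L real)"
  where "L_to_dual \<iota> v = blinfun_inner_right v o\<^sub>L \<iota>"

lemma L_to_dual_apply [simp]: "blinfun_apply (L_to_dual \<iota> v) x = v \<bullet> blinfun_apply \<iota> x"
  by (simp add: L_to_dual_def)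

definition self_adjoint_op :: "('h::{real_inner,banach} \<Rightarrow>\<^sub>L ('h \<Rightarrow>\<^sub>L real)) \<Rightarrow> bool"
  where "self_adjoint_op A \<longleftrightarrow> (\<forall>v w. A v w = A w v)"

text \<open>
  Strict positivity of an operator from \<open>\<H>\<close> to its dual is understood in the usual sense of
  \<open>\<H>\<close>-ellipticity (positive and bounded below); pointwise positivity alone would not
  guarantee that the evolution equation or its discretisation is solvable.
\<close>

definition strictly_positive_definite_op :: "('h::{real_inner,banach} \<Rightarrow>\<^sub>L ('h \<Rightarrow>\<^sub>L real)) \<Rightarrow> bool"
  where "strictly_positive_definite_op A \<longleftrightarrow> (\<exists>c>0. \<forall>v. A v v \<ge> c * (norm v)\<^sup>2)"

text \<open>\<open>op_on_L \<iota> A v\<close> is \<open>A v\<close> for an element \<open>v\<close> of \<open>\<L>\<close>; it is meaningful only if \<open>v\<close> is in \<open>range \<iota>\<close>.\<close>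

definition op_on_L ::
    "('h::{real_inner,banach} \<Rightarrow>\<^sub>L 'l::{real_inner,banach}) \<Rightarrow> ('h \<Rightarrow>\<^sub>L ('h \<Rightarrow>\<^sub>L real)) \<Rightarrow> 'l \<Rightarrow> ('h \<Rightarrow>\<^sub>L real)"
  where "op_on_L \<iota> A v = A (inv (blinfun_apply \<iota>) v)"

text \<open>
  The elements \<open>v\<close> of \<open>\<H>\<close> (seen in \<open>\<L>\<close>) for which the functional \<open>A v\<close> belongs to \<open>\<L>\<close>, and
  \<open>A v\<close> as an element of \<open>\<L>\<close> for those \<open>v\<close>. It is uniquely determined, since the embedding is dense.
\<close>

definition L_domain ::
    "('h::{real_inner,banach} \<Rightarrow>\<^sub>L 'l::{real_inner,banach}) \<Rightarrow> ('h \<Rightarrow>\<^sub>L ('h \<Rightarrow>\<^sub>L real)) \<Rightarrow> 'l set"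
  where "L_domain \<iota> A = {v \<in> range (blinfun_apply \<iota>). op_on_L \<iota> A v \<in> range (L_to_dual \<iota>)}"

definition L_valued_op ::
    "('h::{real_inner,banach} \<Rightarrow>\<^sub>L 'l::{real_inner,banach}) \<Rightarrow> ('h \<Rightarrow>\<^sub>L ('h \<Rightarrow>\<^sub>L real)) \<Rightarrow> 'l \<Rightarrow> 'l"
  where "L_valued_op \<iota> A v = inv (L_to_dual \<iota>) (op_on_L \<iota> A v)"


section \<open>The evolution equation\<close>

text \<open>
  The equation holds in the dual of \<open>\<H>\<close>, for a right-hand side with values in that dual; at the
  end point \<open>T\<close> the derivative is one-sided.
\<close>

definition is_solution ::
    "('h::{real_inner,banach} \<Rightarrow>\<^sub>L 'l::{real_inner,banach}) \<Rightarrow> ('h \<Rightarrow>\<^sub>L ('h \<Rightarrow>\<^sub>L real)) \<Rightarrow> real \<Rightarrow>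
     (real \<Rightarrow> ('h \<Rightarrow>\<^sub>L real)) \<Rightarrow> 'l \<Rightarrow> (real \<Rightarrow> 'l) \<Rightarrow> bool"
  where "is_solution \<iota> A T f u0 u \<longleftrightarrow>
    continuous_on {0..T} u \<and>
    (\<forall>s\<in>{0<..T}. u s \<in> range (blinfun_apply \<iota>)) \<and>
    (\<forall>s\<in>{0<..T}. ((\<lambda>s. L_to_dual \<iota> (u s)) has_vector_derivative (f s - op_on_L \<iota> A (u s)))
                    (at s within {0..T})) \<and>
    u 0 = u0"

text \<open>Iterated derivatives relative to a set, so one-sided at the end points of an interval.\<close>

primrec nth_vector_deriv :: "nat \<Rightarrow> real set \<Rightarrow> (real \<Rightarrow> 'a::real_normed_vector) \<Rightarrow> real \<Rightarrow> 'a"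
  where
    "nth_vector_deriv 0 S v = v"
  | "nth_vector_deriv (Suc m) S v = (\<lambda>s. vector_derivative (nth_vector_deriv m S v) (at s within S))"

definition C_times_on :: "nat \<Rightarrow> real set \<Rightarrow> (real \<Rightarrow> 'a::real_normed_vector) \<Rightarrow> bool"
  where "C_times_on m S v \<longleftrightarrow>
    (\<forall>i<m. \<forall>s\<in>S. nth_vector_deriv i S v differentiable (at s within S)) \<and>
    continuous_on S (nth_vector_deriv m S v)"


section \<open>The discontinuous Galerkin method\<close>

definition time_levels :: "real \<Rightarrow> nat \<Rightarrow> (nat \<Rightarrow> real) \<Rightarrow> bool"
  where "time_levels T N t \<longleftrightarrow> t 0 = 0 \<and> t N = T \<and> (\<forall>n\<in>{1..N}. t (n - 1) < t n)"

abbreviation time_interval :: "(nat \<Rightarrow> real) \<Rightarrow> nat \<Rightarrow> real set"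
  where "time_interval t n \<equiv> {t (n - 1)<..<t n}"

definition interval_norm :: "(nat \<Rightarrow> real) \<Rightarrow> nat \<Rightarrow> (real \<Rightarrow> 'a::real_normed_vector) \<Rightarrow> real"
  where "interval_norm t n v = (SUP s\<in>time_interval t n. norm (v s))"

definition dG_space :: "nat \<Rightarrow> nat \<Rightarrow> (nat \<Rightarrow> real) \<Rightarrow> (real \<Rightarrow> 'h::real_normed_vector) set"
  where "dG_space r N t =
    {X. \<forall>n\<in>{1..N}. \<exists>c :: nat \<Rightarrow> 'h. \<forall>s\<in>time_interval t n. X s = (\<Sum>j<r. s ^ j *\<^sub>R c j)}"

definition limit_right :: "(nat \<Rightarrow> real) \<Rightarrow> (real \<Rightarrow> 'h::real_normed_vector) \<Rightarrow> nat \<Rightarrow> 'h"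
  where "limit_right t X n = Lim (at_right (t n)) X"

definition limit_left :: "(nat \<Rightarrow> real) \<Rightarrow> (real \<Rightarrow> 'h::real_normed_vector) \<Rightarrow> nat \<Rightarrow> 'h"
  where "limit_left t X n = Lim (at_left (t n)) X"

text \<open>The value of \<open>U\<close> at \<open>t n\<close> from the left, with the convention that it is \<open>u0\<close> for \<open>n = 0\<close>.\<close>

definition dG_left ::
    "('h::{real_inner,banach} \<Rightarrow>\<^sub>L 'l::{real_inner,banach}) \<Rightarrow> (nat \<Rightarrow> real) \<Rightarrow> 'l \<Rightarrow> (real \<Rightarrow> 'h) \<Rightarrow> nat \<Rightarrow> 'l"
  where "dG_left \<iota> t u0 U n = (if n = 0 then u0 else \<iota> (limit_left t U n))"

text \<open>
  The integral of \<open>\<langle>f, X\<rangle>\<close> is required to exist; the other integrand is a polynomial on the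
  interval.
\<close>

definition is_dG_solution ::
    "('h::{real_inner,banach} \<Rightarrow>\<^sub>L 'l::{real_inner,banach}) \<Rightarrow> ('h \<Rightarrow>\<^sub>L ('h \<Rightarrow>\<^sub>L real)) \<Rightarrow> nat \<Rightarrow> nat \<Rightarrow>
     (nat \<Rightarrow> real) \<Rightarrow> (real \<Rightarrow> ('h \<Rightarrow>\<^sub>L real)) \<Rightarrow> 'l \<Rightarrow> (real \<Rightarrow> 'h) \<Rightarrow> bool"
  where "is_dG_solution \<iota> A r N t f u0 U \<longleftrightarrow>
    U \<in> dG_space r N t \<and>
    (\<forall>X\<in>dG_space r N t. \<forall>n\<in>{1..N}.
      (\<lambda>s. f s (X s)) integrable_on time_interval t n \<and>
      \<iota> (limit_right t U (n - 1)) \<bullet> \<iota> (limit_right t X (n - 1)) +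
        integral (time_interval t n)
          (\<lambda>s. (L_to_dual \<iota> (\<iota> (vector_derivative U (at s))) + A (U s)) (X s)) =
      dG_left \<iota> t u0 U (n - 1) \<bullet> \<iota> (limit_right t X (n - 1)) +
        integral (time_interval t n) (\<lambda>s. f s (X s)))"


section \<open>Legendre polynomials\<close>

text \<open>Rodrigues' formula.\<close>

definition legendre_poly :: "nat \<Rightarrow> real poly"
  where "legendre_poly j = smult (1 / (2 ^ j * fact j)) ((pderiv ^^ j) ([:-1, 0, 1:] ^ j))"

lemma legendre_poly_1: "poly (legendre_poly j) 1 = 1"
proof -
  have *: "poly ((pderiv ^^ j) ([:-1, 1:] ^ j * q)) 1 = fact j * poly q 1" for q :: "real poly"
  proof (induction j arbitrary: q)
    case (Suc j)
    have "pderiv ([:-1, 1:] ^ Suc j * q) =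
        [:-1, 1:] ^ j * (smult (of_nat (Suc j)) q + [:-1, 1:] * pderiv q)"
      unfolding pderiv_mult pderiv_power_Suc
      by (simp add: pderiv_pCons algebra_simps)
    then show ?case
      by (simp only: funpow_Suc_right o_apply Suc.IH) simp
  qed simp
  have "[:-1, 0, 1:] ^ j = [:-1, 1:] ^ j * [:1, 1::real:] ^ j"
    by (simp flip: power_mult_distrib)
  with * [of "[:1, 1:] ^ j"] show ?thesis
    by (simp add: legendre_poly_def)
qed

text \<open>
  In \<open>local_legendre\<close>, the argument of the polynomial is the solution \<open>\<tau>\<close> of
  \<open>s = ((1 - \<tau>) * t (n - 1) + (1 + \<tau>) * t n) / 2\<close>.
\<close>

definition local_legendre :: "(nat \<Rightarrow> real) \<Rightarrow> nat \<Rightarrow> nat \<Rightarrow> real \<Rightarrow> real"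
  where "local_legendre t n j s =
    poly (legendre_poly j) ((2 * s - t (n - 1) - t n) / (t n - t (n - 1)))"

definition legendre_coeff :: "(nat \<Rightarrow> real) \<Rightarrow> nat \<Rightarrow> nat \<Rightarrow> (real \<Rightarrow> 'a::banach) \<Rightarrow> 'a"
  where "legendre_coeff t n j v =
    ((2 * real j + 1) / (t n - t (n - 1))) *\<^sub>R
      integral (time_interval t n) (\<lambda>s. local_legendre t n j s *\<^sub>R v s)"

end

theory Submission
  imports Defs
begin

text \<open>
Let \<open>k\<close> be the length of the step \<open>[a, b]\<close>, \<open>p\<^sub>j\<close> the Legendre polynomials on it, and \<open>a\<^sub>r(u)\<close> the
coefficient of \<open>u\<close> of order \<open>r\<close>. The right Radau projection \<open>R u\<close> is the polynomial of degree less
than \<open>r\<close> that agrees with \<open>u\<close> at \<open>b\<close> and has the same Legendre coefficients of order less than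
\<open>r - 1\<close>. The quantity to be estimated splits into
\<open>U - u + a\<^sub>r(u) (p\<^sub>r - p\<^sub>r\<^sub>-\<^sub>1) = (U - R u) + (R u - u + a\<^sub>r(u) (p\<^sub>r - p\<^sub>r\<^sub>-\<^sub>1))\<close>.

The second summand, here called the Radau defect of \<open>u\<close>, vanishes if \<open>u\<close> is a polynomial of degree
at most \<open>r\<close>: the projection maps \<open>p\<^sub>r\<close> to \<open>p\<^sub>r\<^sub>-\<^sub>1\<close>, and it fixes the lower ones. In the
supremum norm, the defect is bounded by a multiple of \<open>u\<close> that depends only on \<open>r\<close>. By Taylor's formula, \<open>u\<close> is a polynomial of degree at
most \<open>r\<close> plus the \<open>(r + 1)\<close>-fold iterated integral of its derivative of order \<open>r + 1\<close>, whose size is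
\<open>k ^ (r + 1)\<close> times that of the derivative (\<open>radau_defect_smooth\<close>).

The first summand \<open>\<theta> = U - R u\<close> is a polynomial that solves the discontinuous Galerkin equations with
initial error \<open>U - u\<close> at \<open>a\<close> and right-hand side \<open>A (u - R u)\<close>, because the projection commutes with
the discrete time derivative (\<open>radau_error_equation\<close>). For this,
\<open>u\<close> must be \<open>\<H>\<close>-valued and continuous on the closed step. By ellipticity its derivative of order \<open>r\<close> is,
so that \<open>u\<close> is a polynomial plus an iterated integral of a continuous \<open>\<H>\<close>-valued function, and the
coefficients of the polynomial belong to \<open>\<H>\<close> because its values on the half-open step do (\<open>smooth_lift\<close>). The same representation shows that \<open>A (u - R u)\<close> is an \<open>\<L>\<close>-valued function
bounded by a multiple of \<open>k ^ r\<close> times the norm of \<open>A\<close> applied to the derivative of order \<open>r\<close>.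

What remains is stability of one step in the supremum norm, with a constant that depends only on \<open>r\<close>
(\<open>dG_step_stability\<close>). Testing with \<open>\<theta>\<close> itself controls the value of \<open>\<theta>\<close> at \<open>a\<close>. Testing with the
\<open>L\<^sup>2\<close>-projection of \<open>\<phi> \<theta>\<close> onto the polynomials of degree less than \<open>r\<close>, where \<open>\<phi>(s) = (b - s) / k\<close>,
controls the mean square of \<open>\<theta>\<close>: in the term with \<open>A\<close> and in the term with the derivative the
projection can be dropped, the former is then nonnegative, and in the latter the slope \<open>-1 / k\<close> of the
weight produces the mean square. On polynomials of fixed degree, mean square and supremum are equivalent.
\<close>


section \<open>Legendre polynomials\<close>

lemma has_integral_pderiv:
  fixes p :: "real poly"
  assumes "a \<le> b"
  shows "(poly (pderiv p) has_integral (poly p b - poly p a)) {a..b}"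
  by (intro fundamental_theorem_of_calculus assms)
     (simp add: has_real_derivative_iff_has_vector_derivative [symmetric] poly_DERIV
        has_field_derivative_at_within)

lemma integral_pderiv:
  fixes p :: "real poly"
  assumes "a \<le> b"
  shows "integral {a..b} (poly (pderiv p)) = poly p b - poly p a"
  using has_integral_pderiv [OF assms] by (rule integral_unique)

lemma poly_integrable [simp]: "poly (p :: real poly) integrable_on {a..b}"
  by (intro integrable_continuous_real continuous_intros)

text \<open>
Integrands occur both as the function \<open>poly p\<close> and as an explicit abstraction; these equations
translate the former into the latter.
\<close>

lemma poly_eta:
  fixes p q :: "real poly"
  shows "poly 0 = (\<lambda>x. 0 :: real)"
    and "poly (smult c p) = (\<lambda>x. c * poly p x)"
    and "poly (p * q) = (\<lambda>x. poly p x * poly q x)"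
  by auto

text \<open>
Each differentiation lowers the multiplicity of a root by at most one.
\<close>

lemma higher_pderiv_power_mult:
  fixes q :: "real poly"
  assumes "m \<le> j"
  shows "[:-c, 1:] ^ (j - m) dvd (pderiv ^^ m) ([:-c, 1:] ^ j * q)"
  using assms
proof (induction m)
  case (Suc m)
  define i where "i = j - Suc m"
  have "j - m = Suc i" using Suc.prems by (simp add: i_def)
  with Suc obtain g where g: "(pderiv ^^ m) ([:-c, 1:] ^ j * q) = [:-c, 1:] ^ Suc i * g"
    by (auto elim: dvdE)
  have "pderiv ([:-c, 1:] ^ Suc i * g)
      = [:-c, 1:] ^ i * (smult (of_nat (Suc i)) g + [:-c, 1:] * pderiv g)"
    unfolding pderiv_mult pderiv_power_Suc by (simp add: pderiv_pCons algebra_simps)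
  then show ?case by (simp add: g flip: i_def)
qed simp

lemma poly_higher_pderiv_legendre_base:
  assumes "m < j" "x = 1 \<or> x = -1"
  shows "poly ((pderiv ^^ m) ([:-1, 0, 1::real:] ^ j)) x = 0"
proof -
  have "[:-1, 0, 1::real:] ^ j = [:-x, 1:] ^ j * [:x, 1:] ^ j"
    using assms(2) by (auto simp flip: power_mult_distrib)
  then obtain q where q: "[:-1, 0, 1::real:] ^ j = [:-x, 1:] ^ j * q" by blast
  have "[:-x, 1:] dvd [:-x, 1:] ^ (j - m)"
    using assms(1) by (simp add: dvd_power)
  also have "\<dots> dvd (pderiv ^^ m) ([:-1, 0, 1::real:] ^ j)"
    unfolding q using assms(1) by (intro higher_pderiv_power_mult) simp
  finally show ?thesis by (simp add: poly_eq_0_iff_dvd)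
qed

lemma legendre_poly_minus_1: "poly (legendre_poly j) (-1) = (-1) ^ j"
proof -
  have *: "poly ((pderiv ^^ j) ([:1, 1:] ^ j * q)) (-1) = fact j * poly q (-1)" for q :: "real poly"
  proof (induction j arbitrary: q)
    case (Suc j)
    have "pderiv ([:1, 1:] ^ Suc j * q) =
        [:1, 1:] ^ j * (smult (of_nat (Suc j)) q + [:1, 1:] * pderiv q)"
      unfolding pderiv_mult pderiv_power_Suc
      by (simp add: pderiv_pCons algebra_simps)
    then show ?case
      by (simp only: funpow_Suc_right o_apply Suc.IH) simp
  qed simp
  have "[:-1, 0, 1:] ^ j = [:1, 1:] ^ j * [:-1, 1::real:] ^ j"
    by (simp add: mult.commute flip: power_mult_distrib)
  with * [of "[:-1, 1:] ^ j"] show ?thesis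
    by (simp add: legendre_poly_def power_minus [of 2])
qed

lemma degree_higher_pderiv: "degree ((pderiv ^^ m) (p :: real poly)) = degree p - m"
  by (induction m) (auto simp: degree_pderiv)

lemma degree_legendre_poly [simp]: "degree (legendre_poly j) = j"
  by (simp add: legendre_poly_def degree_higher_pderiv degree_power_eq)

lemma legendre_poly_nonzero [simp]: "legendre_poly j \<noteq> 0"
  using legendre_poly_1 [of j] by auto

text \<open>
Integration by parts, \<open>m\<close> times: the boundary terms vanish since the derivatives of
\<open>(x\<^sup>2 - 1) ^ j\<close> of order less than \<open>j\<close> are zero at both end points.
\<close>

lemma integral_higher_pderiv_legendre_base:
  assumes "(pderiv ^^ m) q = 0" "m \<le> j"
  shows "integral {-1..1} (poly ((pderiv ^^ m) ([:-1, 0, 1::real:] ^ j) * q)) = 0"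
  using assms
proof (induction m arbitrary: q)
  case (Suc m)
  let ?w = "(pderiv ^^ m) ([:-1, 0, 1::real:] ^ j)"
  have "integral {-1..1} (poly (pderiv ?w * q)) + integral {-1..1} (poly (?w * pderiv q))
      = integral {-1..1} (poly (pderiv (?w * q)))"
    by (subst integral_add [symmetric])
       (auto intro!: integral_cong simp: pderiv_mult mult.commute simp flip: poly_mult)
  also have "\<dots> = 0"
    using Suc.prems(2) by (simp add: integral_pderiv poly_higher_pderiv_legendre_base)
  also have "integral {-1..1} (poly (?w * pderiv q)) = 0"
    using Suc.prems by (intro Suc.IH) (simp_all add: funpow_swap1)
  finally show ?case by simp
qed (simp add: poly_eta)

lemma legendre_poly_orthogonal_lower:
  assumes "degree q < j"
  shows "integral {-1..1} (poly (legendre_poly j * q)) = 0"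
proof -
  have "degree ((pderiv ^^ (j - 1)) q) = 0"
    using assms by (simp add: degree_higher_pderiv)
  then have "pderiv ((pderiv ^^ (j - 1)) q) = 0" by (simp add: pderiv_eq_0_iff)
  with assms have "(pderiv ^^ j) q = 0"
    by (cases j) auto
  then show ?thesis
    using integral_higher_pderiv_legendre_base [of j q j]
    by (simp add: legendre_poly_def poly_eta)
qed

text \<open>
Integrate the derivative of \<open>x P\<^sub>j(x)\<^sup>2\<close>: the boundary values give \<open>2\<close>, and on the other side
\<open>x P\<^sub>j'(x)\<close> is \<open>j P\<^sub>j(x)\<close> up to a polynomial of lower degree, which is orthogonal to \<open>P\<^sub>j\<close>.
\<close>

lemma legendre_poly_norm:
  "integral {-1..1} (poly (legendre_poly j * legendre_poly j)) = 2 / (2 * real j + 1)"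
proof -
  let ?P = "legendre_poly j"
  define I where "I = integral {-1..1} (poly (?P * ?P))"
  \<comment> \<open>\<open>x P\<^sub>j' - j P\<^sub>j\<close>, in which the leading terms cancel\<close>
  define q where "q = pCons 0 (pderiv ?P) - smult (real j) ?P"
  have "integral {-1..1} (poly (?P * q)) = 0"
  proof (cases "q = 0")
    case False
    have "degree q \<le> j"
      unfolding q_def
      by (intro degree_diff_le) (auto simp: degree_pCons_eq_if degree_pderiv pderiv_eq_0_iff)
    moreover have "coeff q j = 0"
      by (cases j) (auto simp: q_def coeff_pderiv)
    ultimately have "degree q < j"
      using False by (metis leading_coeff_0_iff nat_less_le)
    then show ?thesis by (rule legendre_poly_orthogonal_lower)
  next
    case True
    then have "poly (?P * q) = (\<lambda>x. 0)" by auto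
    then show ?thesis by simp
  qed
  then have "integral {-1..1} (\<lambda>x. 2 * poly (?P * q) x) = 0" 
    by (simp add: poly_eta)
  moreover have "integral {-1..1} (\<lambda>x. 2 * poly (?P * q) x + (2 * real j + 1) * poly (?P * ?P) x)
      = integral {-1..1} (poly (pderiv (pCons 0 (?P * ?P))))"
    by (intro integral_cong) (simp add: q_def pderiv_pCons pderiv_mult algebra_simps)
  moreover have "\<dots> = 2"
    by (simp add: integral_pderiv legendre_poly_1 legendre_poly_minus_1 flip: power_mult_distrib)
  ultimately have "(2 * real j + 1) * I = 2"
    unfolding I_def
    by (subst (asm) integral_add)
      (auto intro!: integrable_continuous_real continuous_intros simp del: poly_mult)
  then show ?thesis by (simp add: I_def field_simps)
qed

lemma legendre_poly_orthogonal:
  "integral {-1..1} (poly (legendre_poly i * legendre_poly j))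
     = (if i = j then 2 / (2 * real j + 1) else 0)"
  using legendre_poly_orthogonal_lower [of "legendre_poly i" j]
    legendre_poly_orthogonal_lower [of "legendre_poly j" i]
  by (cases i j rule: linorder_cases) (auto simp: legendre_poly_norm mult.commute)

text \<open>
On \<open>[-1, 1]\<close> the powers of the argument are at most \<open>1\<close>, so this bounds the polynomial there. Any bound
that depends on \<open>j\<close> alone serves the purpose; the optimal one is \<open>1\<close>.
\<close>

definition legendre_bound :: "nat \<Rightarrow> real"
  where "legendre_bound j = (\<Sum>i\<le>j. \<bar>coeff (legendre_poly j) i\<bar>)"

lemma legendre_poly_bound:
  assumes "\<bar>x\<bar> \<le> 1"
  shows "\<bar>poly (legendre_poly j) x\<bar> \<le> legendre_bound j"
proof -
  have "\<bar>poly (legendre_poly j) x\<bar> \<le> (\<Sum>i\<le>j. \<bar>coeff (legendre_poly j) i * x ^ i\<bar>)"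
    unfolding poly_altdef degree_legendre_poly by (rule sum_abs)
  also have "\<dots> \<le> legendre_bound j"
    unfolding legendre_bound_def abs_mult
    using assms by (intro sum_mono mult_right_le_one_le) (auto simp: power_abs power_le_one)
  finally show ?thesis .
qed

lemma legendre_bound_nonneg: "0 \<le> legendre_bound j"
  by (simp add: legendre_bound_def sum_nonneg)


section \<open>Vector-valued polynomials\<close>

text \<open>
Polynomials of degree less than \<open>m\<close> with coefficients in a vector space. Counting coefficients rather
than bounding the degree gives the zero space for \<open>m = 0\<close>.
\<close>

definition vpoly :: "nat \<Rightarrow> (real \<Rightarrow> 'a::real_normed_vector) \<Rightarrow> bool"
  where "vpoly m X \<longleftrightarrow> (\<exists>c. \<forall>s. X s = (\<Sum>j<m. s ^ j *\<^sub>R c j))"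

lemma vpolyI: "(\<And>s. X s = (\<Sum>j<m. s ^ j *\<^sub>R c j)) \<Longrightarrow> vpoly m X"
  unfolding vpoly_def by blast

lemma vpoly_add:
  assumes "vpoly m X" "vpoly m Y"
  shows "vpoly m (\<lambda>s. X s + Y s)"
proof -
  obtain c d where "\<And>s. X s = (\<Sum>j<m. s ^ j *\<^sub>R c j)" "\<And>s. Y s = (\<Sum>j<m. s ^ j *\<^sub>R d j)"
    using assms by (auto simp: vpoly_def)
  then have "X s + Y s = (\<Sum>j<m. s ^ j *\<^sub>R (c j + d j))" for s
    by (simp add: scaleR_add_right sum.distrib)
  then show ?thesis by (rule vpolyI)
qed

lemma vpoly_0: "vpoly m (\<lambda>s. 0)"
  unfolding vpoly_def by (rule exI [of _ "\<lambda>_. 0"]) simp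

lemma vpoly_sum:
  assumes "\<And>i. i \<in> S \<Longrightarrow> vpoly m (X i)"
  shows "vpoly m (\<lambda>s. \<Sum>i\<in>S. X i s)"
  using assms by (induction S rule: infinite_finite_induct) (auto intro: vpoly_0 vpoly_add)

lemma vpoly_linear:
  assumes "vpoly m X" "bounded_linear f"
  shows "vpoly m (\<lambda>s. f (X s))"
proof -
  interpret bounded_linear f by fact
  obtain c where "\<And>s. X s = (\<Sum>j<m. s ^ j *\<^sub>R c j)"
    using assms(1) by (auto simp: vpoly_def)
  then have "f (X s) = (\<Sum>j<m. s ^ j *\<^sub>R f (c j))" for s by (simp add: sum scaleR)
  then show ?thesis by (rule vpolyI)
qed

lemma vpoly_diff:
  assumes "vpoly m X" "vpoly m Y"
  shows "vpoly m (\<lambda>s. X s - Y s)"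
  using vpoly_add [OF assms(1) vpoly_linear [OF assms(2) bounded_linear_minus [OF bounded_linear_ident]]]
  by simp

lemma vpoly_poly:
  assumes "degree q < m"
  shows "vpoly m (\<lambda>s. poly q s *\<^sub>R c)"
proof -
  have "poly q s *\<^sub>R c = (\<Sum>j<m. s ^ j *\<^sub>R (coeff q j *\<^sub>R c))" for s
  proof -
    have "poly q s = (\<Sum>j\<le>degree q. coeff q j * s ^ j)" by (rule poly_altdef)
    also have "\<dots> = (\<Sum>j<m. coeff q j * s ^ j)"
      using assms by (intro sum.mono_neutral_left) (auto simp: coeff_eq_0)
    finally show ?thesis by (simp add: scaleR_sum_left mult.commute)
  qed
  then show ?thesis by (rule vpolyI)
qed

lemma vpoly_power:
  assumes "j < m"
  shows "vpoly m (\<lambda>s. s ^ j *\<^sub>R c)"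
  using vpoly_poly [of "monom 1 j" m c] assms by (simp add: degree_monom_eq poly_monom)

lemma vpoly_mono:
  assumes "vpoly m X" "m \<le> m'"
  shows "vpoly m' X"
proof -
  obtain c where c: "\<And>s. X s = (\<Sum>j<m. s ^ j *\<^sub>R c j)" using assms(1) by (auto simp: vpoly_def)
  have "vpoly m' (\<lambda>s. \<Sum>j<m. s ^ j *\<^sub>R c j)"
    using assms(2) by (intro vpoly_sum vpoly_power) auto
  then show ?thesis by (simp add: c [symmetric])
qed

lemma vpoly_has_derivative:
  assumes "vpoly m X"
  shows "\<exists>X'. vpoly (m - 1) X' \<and> (\<forall>s S. (X has_vector_derivative X' s) (at s within S))"
proof -
  obtain c where c: "\<And>s. X s = (\<Sum>j<m. s ^ j *\<^sub>R c j)"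
    using assms by (auto simp: vpoly_def)
  then have X: "X = (\<lambda>s. \<Sum>j<m. s ^ j *\<^sub>R c j)" by blast
  define X' where "X' s = (\<Sum>j<m. (real j * s ^ (j - 1)) *\<^sub>R c j)" for s
  have "vpoly (m - 1) (\<lambda>s. (real j * s ^ (j - 1)) *\<^sub>R c j)" if "j < m" for j
  proof (cases "j = 0")
    case False
    with that have "vpoly (m - 1) (\<lambda>s. s ^ (j - 1) *\<^sub>R (real j *\<^sub>R c j))"
      by (intro vpoly_power) simp
    then show ?thesis by (simp add: mult.commute)
  qed (simp add: vpoly_0)
  then have "vpoly (m - 1) X'" unfolding X'_def by (intro vpoly_sum) auto
  moreover have "((\<lambda>s. s ^ j *\<^sub>R c j) has_vector_derivative (real j * s ^ (j - 1)) *\<^sub>R c j) (at s within S)"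
    for j s S
  proof -
    have "((\<lambda>s. s ^ j) has_field_derivative real j * s ^ (j - 1)) (at s within S)"
      by (auto intro!: derivative_eq_intros)
    from has_vector_derivative_scaleR [OF this has_vector_derivative_const, of "c j"] show ?thesis
      by simp
  qed
  then have "(X has_vector_derivative X' s) (at s within S)" for s S
    unfolding X X'_def by (intro has_vector_derivative_sum)
  ultimately show ?thesis by (intro exI [of _ X']) simp
qed

lemma vpoly_continuous_on:
  assumes "vpoly m X"
  shows "continuous_on S X"
proof -
  from vpoly_has_derivative [OF assms]
  obtain X' where "vpoly (m - 1) X' \<and> (\<forall>s S. (X has_vector_derivative X' s) (at s within S))" ..
  then have "\<And>s. (X has_vector_derivative X' s) (at s within S)" by simp
  then show ?thesis by (rule continuous_on_vector_derivative)
qed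


section \<open>Legendre expansions on an interval\<close>

locale time_step =
  fixes a b :: real
  assumes ab: "a < b"
begin

definition lpol :: "nat \<Rightarrow> real poly"
  where "lpol j = pcompose (legendre_poly j) [:- (a + b) / (b - a), 2 / (b - a):]"

lemma poly_lpol: "poly (lpol j) s = poly (legendre_poly j) ((2 * s - a - b) / (b - a))"
proof -
  have "- (a + b) / (b - a) + s * (2 / (b - a)) = (2 * s - a - b) / (b - a)"
    by (simp add: add_divide_distrib diff_divide_distrib)
  then show ?thesis by (simp add: lpol_def poly_pcompose)
qed

lemma degree_lpol [simp]: "degree (lpol j) = j"
  using ab by (simp add: lpol_def degree_pcompose)

lemma lpol_right [simp]: "poly (lpol j) b = 1"
proof -
  have "2 * b - a - b = b - a" by simp
  then show ?thesis using ab by (simp add: poly_lpol legendre_poly_1 del: diff_divide_distrib)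
qed

lemma lpol_nonzero [simp]: "lpol j \<noteq> 0"
  using lpol_right [of j] by force

lemma lpol_bound:
  assumes "s \<in> {a..b}"
  shows "\<bar>poly (lpol j) s\<bar> \<le> legendre_bound j"
proof -
  have "\<bar>2 * s - a - b\<bar> \<le> b - a" using assms by auto
  then have "\<bar>(2 * s - a - b) / (b - a)\<bar> \<le> 1"
    using ab by (simp add: abs_divide del: diff_divide_distrib)
  then show ?thesis unfolding poly_lpol by (rule legendre_poly_bound)
qed

lemma lpol_orthogonal:
  "integral {a..b} (\<lambda>s. poly (lpol i) s * poly (lpol j) s)
     = (if i = j then (b - a) / (2 * real j + 1) else 0)"
proof -
  let ?I = "if i = j then 2 / (2 * real j + 1) else 0"
  let ?f = "\<lambda>x. poly (legendre_poly i) x * poly (legendre_poly j) x"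
  have "?f integrable_on {-1..1}"
    by (intro integrable_continuous_real continuous_intros)
  then have "(?f has_integral ?I) (cbox (-1) 1)"
    using legendre_poly_orthogonal [of i j] by (auto simp: poly_eta has_integral_iff)
  then have "((\<lambda>x. ?f (m * x + c)) has_integral (?I / m)) {(-1 - c) / m..(1 - c) / m}" if "m > 0" for m c
    using has_integral_affinity' [OF _ that, of ?f ?I "-1" 1 c]
    by (simp add: divide_inverse mult.commute)
  from this [of "2 / (b - a)" "- (a + b) / (b - a)"] ab
  have *: "((\<lambda>x. ?f (2 / (b - a) * x + - (a + b) / (b - a))) has_integral (?I / (2 / (b - a))))
     {(-1 - (- (a + b) / (b - a))) / (2 / (b - a))..(1 - (- (a + b) / (b - a))) / (2 / (b - a))}"
    by simp
  have "(-1 - (- (a + b) / (b - a))) / (2 / (b - a)) = a" "(1 - (- (a + b) / (b - a))) / (2 / (b - a)) = b"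
    using ab by (simp_all add: field_simps)
  moreover have "2 / (b - a) * x + - (a + b) / (b - a) = (2 * x - a - b) / (b - a)" for x
    by (simp add: add_divide_distrib diff_divide_distrib)
  moreover have "?I / (2 / (b - a)) = (if i = j then (b - a) / (2 * real j + 1) else 0)"
    by simp
  ultimately show ?thesis
    using integral_unique [OF *] by (simp only: poly_lpol)
qed

text \<open>
Eliminate the leading coefficient: the polynomial of index \<open>m\<close> has degree exactly \<open>m\<close>.
\<close>

lemma lpol_basis:
  assumes "\<And>i. i \<ge> m \<Longrightarrow> coeff q i = 0"
  shows "\<exists>c. q = (\<Sum>j<m. smult (c j) (lpol j))"
  using assms
proof (induction m arbitrary: q)
  case 0
  then have "q = 0" by (intro poly_eqI) simp
  then show ?case by simp
next
  case (Suc m)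
  define d where "d = coeff q m / lead_coeff (lpol m)"
  have "coeff (q - smult d (lpol m)) i = 0" if "i \<ge> m" for i
  proof (cases "i = m")
    case True
    have "coeff (lpol m) m \<noteq> 0"
      using leading_coeff_0_iff [of "lpol m"] by simp
    then show ?thesis by (simp add: True d_def)
  next
    case False
    then show ?thesis using that Suc.prems by (simp add: coeff_eq_0)
  qed
  from Suc.IH [OF this] obtain c where "q - smult d (lpol m) = (\<Sum>j<m. smult (c j) (lpol j))"
    by blast
  then have "q = (\<Sum>j<Suc m. smult ((c(m := d)) j) (lpol j))"
    by (simp add: diff_eq_eq)
  then show ?case by blast
qed

lemma vpoly_lpol_expansion:
  fixes X :: "real \<Rightarrow> 'a::real_normed_vector"
  assumes "vpoly m X"
  shows "\<exists>d. \<forall>s. X s = (\<Sum>i<m. poly (lpol i) s *\<^sub>R d i)"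
proof -
  obtain c where c: "\<And>s. X s = (\<Sum>j<m. s ^ j *\<^sub>R c j)"
    using assms by (auto simp: vpoly_def)
  have "\<forall>j. \<exists>e. j < m \<longrightarrow> monom 1 j = (\<Sum>i<m. smult (e i) (lpol i))"
    by (auto intro!: lpol_basis)
  then obtain e where e: "\<And>j. j < m \<Longrightarrow> monom 1 j = (\<Sum>i<m. smult (e j i) (lpol i))"
    by metis
  have "s ^ j = (\<Sum>i<m. e j i * poly (lpol i) s)" if "j < m" for s j
    using arg_cong [OF e [OF that], of "\<lambda>p. poly p s"] by (simp add: poly_monom poly_sum)
  then have "X s = (\<Sum>j<m. \<Sum>i<m. (e j i * poly (lpol i) s) *\<^sub>R c j)" for s
    by (simp add: c scaleR_sum_left)
  also have "(\<Sum>j<m. \<Sum>i<m. (e j i * poly (lpol i) s) *\<^sub>R c j)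
      = (\<Sum>i<m. poly (lpol i) s *\<^sub>R (\<Sum>j<m. e j i *\<^sub>R c j))" for s
    by (subst sum.swap) (simp add: scaleR_sum_right mult.commute)
  finally show ?thesis by (intro exI allI)
qed

definition lcoef :: "nat \<Rightarrow> (real \<Rightarrow> 'a::banach) \<Rightarrow> 'a"
  where "lcoef j v = ((2 * real j + 1) / (b - a)) *\<^sub>R integral {a..b} (\<lambda>s. poly (lpol j) s *\<^sub>R v s)"

lemma lpol_scaleR_integrable:
  fixes v :: "real \<Rightarrow> 'a::banach"
  assumes "continuous_on {a..b} v"
  shows "(\<lambda>s. poly p s *\<^sub>R v s) integrable_on {a..b}"
  using assms by (intro integrable_continuous_real continuous_intros)

lemma integral_lpol_scaleR:
  "integral {a..b} (\<lambda>s. poly (lpol j) s *\<^sub>R v s) = ((b - a) / (2 * real j + 1)) *\<^sub>R lcoef j v"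
  using ab by (simp add: lcoef_def) 

lemma lcoef_cong:
  assumes "\<And>s. s \<in> {a..b} \<Longrightarrow> v s = w s"
  shows "lcoef j v = lcoef j w"
  unfolding lcoef_def using assms by (auto intro!: integral_cong arg_cong2 [of _ _ _ _ scaleR])

lemma lcoef_add:
  assumes "continuous_on {a..b} v" "continuous_on {a..b} w"
  shows "lcoef j (\<lambda>s. v s + w s) = lcoef j v + lcoef j w"
  unfolding lcoef_def
  by (simp add: scaleR_add_right integral_add lpol_scaleR_integrable assms)

lemma lcoef_sum:
  assumes "\<And>i. i \<in> S \<Longrightarrow> continuous_on {a..b} (v i)" "finite S"
  shows "lcoef j (\<lambda>s. \<Sum>i\<in>S. v i s) = (\<Sum>i\<in>S. lcoef j (v i))"
  unfolding lcoef_def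
  by (simp add: scaleR_sum_right integral_sum lpol_scaleR_integrable assms)

text \<open>
This moves Legendre coefficients, and with them the projections below, between \<open>\<H>\<close>, \<open>\<L>\<close> and the
dual of \<open>\<H>\<close>.
\<close>

lemma lcoef_linear:
  assumes "continuous_on {a..b} v" "bounded_linear f"
  shows "lcoef j (\<lambda>s. f (v s)) = f (lcoef j v)"
proof -
  interpret bounded_linear f by fact
  have "integral {a..b} (f \<circ> (\<lambda>s. poly (lpol j) s *\<^sub>R v s)) = f (integral {a..b} (\<lambda>s. poly (lpol j) s *\<^sub>R v s))"
    by (intro integral_linear lpol_scaleR_integrable assms)
  then show ?thesis by (simp add: lcoef_def o_def scaleR)
qed

lemma lcoef_lpol:
  "lcoef j (\<lambda>s. poly (lpol i) s *\<^sub>R c) = (if i = j then c else 0)"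
proof -
  have "integral {a..b} ((\<lambda>x. x *\<^sub>R c) \<circ> (\<lambda>s. poly (lpol j) s * poly (lpol i) s))
      = integral {a..b} (\<lambda>s. poly (lpol j) s * poly (lpol i) s) *\<^sub>R c"
    by (intro integral_linear integrable_continuous_real continuous_intros bounded_linear_scaleR_left)
  then show ?thesis
    using ab by (auto simp: lcoef_def o_def lpol_orthogonal)
qed

lemma lcoef_expansion:
  "lcoef j (\<lambda>s. \<Sum>i<m. poly (lpol i) s *\<^sub>R c i) = (if j < m then c j else 0)"
  by (subst lcoef_sum) (auto intro!: continuous_intros simp: lcoef_lpol)

definition avg :: "(real \<Rightarrow> real) \<Rightarrow> real"
  where "avg v = integral {a..b} v / (b - a)"

lemma lcoef_bound_avg:
  assumes "continuous_on {a..b} v"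
  shows "norm (lcoef j v) \<le> (2 * real j + 1) * legendre_bound j * avg (\<lambda>s. norm (v s))"
proof -
  have "norm (integral {a..b} (\<lambda>s. poly (lpol j) s *\<^sub>R v s))
      \<le> integral {a..b} (\<lambda>s. legendre_bound j * norm (v s))"
    using assms
    by (intro integral_norm_bound_integral lpol_scaleR_integrable integrable_continuous_real
        continuous_intros) (auto intro!: mult_right_mono lpol_bound)
  then show ?thesis
    using ab by (simp add: lcoef_def avg_def divide_right_mono mult_left_mono mult.assoc)
qed

lemma avg_le:
  assumes "continuous_on {a..b} v" "\<And>s. s \<in> {a..b} \<Longrightarrow> v s \<le> B"
  shows "avg v \<le> B"
proof -
  have "integral {a..b} v \<le> integral {a..b} (\<lambda>s. B)"
    using assms by (intro integral_le integrable_continuous_real) auto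
  then show ?thesis using ab by (simp add: avg_def field_simps)
qed

text \<open>
The variance of \<open>v\<close> is nonnegative.
\<close>

lemma avg_square_le:
  assumes "continuous_on {a..b} v"
  shows "(avg v)\<^sup>2 \<le> avg (\<lambda>s. (v s)\<^sup>2)"
proof -
  have "0 \<le> integral {a..b} (\<lambda>s. (v s - avg v)\<^sup>2)"
    using assms by (intro integral_nonneg integrable_continuous_real continuous_intros) auto
  also have "integral {a..b} (\<lambda>s. (v s - avg v)\<^sup>2)
      = integral {a..b} (\<lambda>s. ((v s)\<^sup>2 - (2 * avg v) * v s) + (avg v)\<^sup>2)"
    by (intro integral_cong) (simp add: power2_eq_square algebra_simps)
  also have "\<dots> = integral {a..b} (\<lambda>s. (v s)\<^sup>2 - (2 * avg v) * v s) + integral {a..b} (\<lambda>s. (avg v)\<^sup>2)"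
    using assms by (intro integral_add integrable_continuous_real continuous_intros)
  also have "integral {a..b} (\<lambda>s. (v s)\<^sup>2 - (2 * avg v) * v s)
      = integral {a..b} (\<lambda>s. (v s)\<^sup>2) - integral {a..b} (\<lambda>s. (2 * avg v) * v s)"
    using assms by (intro integral_diff integrable_continuous_real continuous_intros)
  also have "integral {a..b} (\<lambda>s. (2 * avg v) * v s) = (2 * avg v) * integral {a..b} v"
    by simp
  also have "integral {a..b} v = (b - a) * avg v"
    using ab by (simp add: avg_def)
  finally have "0 \<le> integral {a..b} (\<lambda>s. (v s)\<^sup>2) - (b - a) * (avg v)\<^sup>2"
    using ab by (simp add: power2_eq_square algebra_simps)
  then show ?thesis
    using ab by (simp add: avg_def [of "\<lambda>s. (v s)\<^sup>2"] pos_le_divide_eq mult.commute)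
qed

text \<open>
The orthogonal projection in \<open>L\<^sup>2(a, b)\<close> onto the polynomials with \<open>m\<close> coefficients.
\<close>

definition l2proj :: "nat \<Rightarrow> (real \<Rightarrow> 'a::banach) \<Rightarrow> real \<Rightarrow> 'a"
  where "l2proj m v s = (\<Sum>j<m. poly (lpol j) s *\<^sub>R lcoef j v)"

lemma vpoly_l2proj: "vpoly m (l2proj m v)"
  unfolding l2proj_def by (intro vpoly_sum vpoly_poly) auto

lemma l2proj_vpoly:
  assumes "vpoly m v"
  shows "l2proj m v s = v s"
proof -
  obtain d where "\<And>s. v s = (\<Sum>i<m. poly (lpol i) s *\<^sub>R d i)"
    using vpoly_lpol_expansion [OF assms] by blast
  then have v: "v = (\<lambda>s. \<Sum>i<m. poly (lpol i) s *\<^sub>R d i)" by blast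
  show ?thesis by (simp add: l2proj_def v lcoef_expansion)
qed

lemma lcoef_l2proj: "j < m \<Longrightarrow> lcoef j (l2proj m v) = lcoef j v"
  using lcoef_expansion [where c = "\<lambda>i. lcoef i v"] by (simp add: l2proj_def [abs_def])

lemma l2proj_linear:
  assumes "continuous_on {a..b} v" "bounded_linear f"
  shows "l2proj m (\<lambda>s. f (v s)) s = f (l2proj m v s)"
proof -
  interpret bounded_linear f by fact
  show ?thesis by (simp add: l2proj_def lcoef_linear assms sum scaleR)
qed

lemma l2proj_add:
  assumes "continuous_on {a..b} v" "continuous_on {a..b} w"
  shows "l2proj m (\<lambda>s. v s + w s) s = l2proj m v s + l2proj m w s"
  by (simp add: l2proj_def lcoef_add assms scaleR_add_right sum.distrib)

end

definition l2proj_bound :: "nat \<Rightarrow> real"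
  where "l2proj_bound m = (\<Sum>j<m. (2 * real j + 1) * (legendre_bound j)\<^sup>2)"

lemma l2proj_bound_nonneg: "0 \<le> l2proj_bound m"
  by (simp add: l2proj_bound_def sum_nonneg)

context time_step
begin

text \<open>
As the projection fixes polynomials, this also contains the inverse estimate that bounds the supremum
of a polynomial by its mean.
\<close>

lemma norm_l2proj_le_avg:
  assumes v: "continuous_on {a..b} v" and "s \<in> {a..b}"
  shows "norm (l2proj m v s) \<le> l2proj_bound m * avg (\<lambda>s. norm (v s))"
proof -
  have "norm (l2proj m v s) \<le> (\<Sum>j<m. norm (poly (lpol j) s *\<^sub>R lcoef j v))"
    unfolding l2proj_def by (rule norm_sum)
  also have "\<dots> \<le> (\<Sum>j<m. legendre_bound j * ((2 * real j + 1) * legendre_bound j * avg (\<lambda>s. norm (v s))))"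
    unfolding norm_scaleR real_norm_def
    by (intro sum_mono mult_mono lpol_bound lcoef_bound_avg assms legendre_bound_nonneg) auto
  also have "\<dots> = l2proj_bound m * avg (\<lambda>s. norm (v s))"
    unfolding l2proj_bound_def sum_distrib_right
    by (intro sum.cong) (auto simp: power2_eq_square)
  finally show ?thesis .
qed

lemma norm_l2proj_le:
  assumes v: "continuous_on {a..b} v" and "s \<in> {a..b}" and B: "\<And>s. s \<in> {a..b} \<Longrightarrow> norm (v s) \<le> B"
  shows "norm (l2proj m v s) \<le> l2proj_bound m * B"
proof -
  have "avg (\<lambda>s. norm (v s)) \<le> B"
    using v B by (intro avg_le) (auto intro!: continuous_intros)
  then have "l2proj_bound m * avg (\<lambda>s. norm (v s)) \<le> l2proj_bound m * B"
    by (intro mult_left_mono l2proj_bound_nonneg)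
  with norm_l2proj_le_avg [OF assms(1,2), of m] show ?thesis by simp
qed

lemma integral_bilinear_lpol_expansion:
  assumes bil: "bounded_bilinear bil" and w: "\<And>s. w s = (\<Sum>j<m. poly (lpol j) s *\<^sub>R d j)"
    and x: "continuous_on {a..b} x"
  shows "integral {a..b} (\<lambda>s. bil (w s) (x s))
     = (\<Sum>j<m. ((b - a) / (2 * real j + 1)) *\<^sub>R (bil (d j) (lcoef j x) :: 'c::banach))"
proof -
  interpret bounded_bilinear bil by fact
  have "integral {a..b} (\<lambda>s. bil (w s) (x s))
      = integral {a..b} (\<lambda>s. \<Sum>j<m. bil (d j) (poly (lpol j) s *\<^sub>R x s))"
    by (simp add: w sum_left scaleR_left scaleR_right)
  also have "\<dots> = (\<Sum>j<m. integral {a..b} (bil (d j) \<circ> (\<lambda>s. poly (lpol j) s *\<^sub>R x s)))"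
    unfolding o_def using x
    by (intro integral_sum integrable_continuous_real continuous_on continuous_intros) auto
  also have "\<dots> = (\<Sum>j<m. bil (d j) (integral {a..b} (\<lambda>s. poly (lpol j) s *\<^sub>R x s)))"
    by (intro sum.cong integral_linear lpol_scaleR_integrable x bounded_linear_right) auto
  finally show ?thesis by (simp add: integral_lpol_scaleR scaleR_right)
qed

text \<open>
Tested with polynomials with \<open>m\<close> coefficients, a function is seen only through its first \<open>m\<close> Legendre
coefficients. The statement for arbitrary bilinear maps covers the inner product as well as the form
given by \<open>A\<close>.
\<close>

lemma integral_bilinear_eq_if_lcoef_eq:
  assumes bil: "bounded_bilinear bil" and w: "vpoly m w"
    and x: "continuous_on {a..b} x" and y: "continuous_on {a..b} y"
    and eq: "\<And>j. j < m \<Longrightarrow> lcoef j x = lcoef j y"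
  shows "integral {a..b} (\<lambda>s. bil (w s) (x s)) = integral {a..b} (\<lambda>s. bil (w s) (y s) :: 'c::banach)"
proof -
  obtain d where d: "\<And>s. w s = (\<Sum>i<m. poly (lpol i) s *\<^sub>R d i)"
    using vpoly_lpol_expansion [OF w] by blast
  show ?thesis
    using eq by (simp add: integral_bilinear_lpol_expansion [OF bil d] x y)
qed


section \<open>The right Radau projection\<close>

text \<open>
The first \<open>r - 1\<close> Legendre coefficients are those of \<open>v\<close>, and the last one is adjusted so that the
value at \<open>b\<close> is matched; recall that \<open>poly (lpol j) b = 1\<close> for all \<open>j\<close>.
\<close>

definition radau :: "nat \<Rightarrow> (real \<Rightarrow> 'a::banach) \<Rightarrow> real \<Rightarrow> 'a"
  where "radau r v s = l2proj (r - 1) v s + poly (lpol (r - 1)) s *\<^sub>R (v b - l2proj (r - 1) v b)"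

lemma radau_right: "radau r v b = v b"
  by (simp add: radau_def)

lemma vpoly_radau:
  assumes "r \<ge> 1"
  shows "vpoly r (radau r v)"
  unfolding radau_def using assms
  by (intro vpoly_add vpoly_poly vpoly_mono [OF vpoly_l2proj]) auto

lemma lcoef_radau:
  assumes "j < r - 1"
  shows "lcoef j (radau r v) = lcoef j v"
  unfolding radau_def using assms
  by (subst lcoef_add) (auto intro!: continuous_intros vpoly_continuous_on [OF vpoly_l2proj]
      simp: lcoef_l2proj lcoef_lpol)

lemma radau_linear:
  assumes "continuous_on {a..b} v" "bounded_linear f"
  shows "radau r (\<lambda>s. f (v s)) s = f (radau r v s)"
proof -
  interpret bounded_linear f by fact
  show ?thesis by (simp add: radau_def l2proj_linear assms add diff scaleR)
qed

lemma radau_add: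
  assumes "continuous_on {a..b} v" "continuous_on {a..b} w"
  shows "radau r (\<lambda>s. v s + w s) s = radau r v s + radau r w s"
  by (simp add: radau_def l2proj_add assms algebra_simps)

lemma radau_cong:
  assumes "\<And>s. s \<in> {a..b} \<Longrightarrow> v s = w s"
  shows "radau r v s = radau r w s"
  using assms ab lcoef_cong [of v w] by (simp add: radau_def l2proj_def)

text \<open>
For \<open>j = r\<close> all retained coefficients vanish, and the value \<open>c\<close> at \<open>b\<close> is carried by the Legendre
polynomial of index \<open>r - 1\<close> alone.
\<close>

lemma radau_lpol:
  assumes "j \<le> r" "1 \<le> r"
  shows "radau r (\<lambda>s. poly (lpol j) s *\<^sub>R c) s = poly (lpol (if j = r then r - 1 else j)) s *\<^sub>R c"
proof -
  have "l2proj (r - 1) (\<lambda>s. poly (lpol j) s *\<^sub>R c) s = (if j < r - 1 then poly (lpol j) s *\<^sub>R c else 0)" for s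
    unfolding l2proj_def lcoef_lpol by (simp add: if_distrib [of "scaleR _"] cong: if_cong)
  note * = this
  consider "j < r - 1" | "j = r - 1" | "j = r" using assms(1) by linarith
  then show ?thesis
  proof cases
    case 1
    then have "j \<noteq> r" by simp
    then show ?thesis unfolding radau_def * using 1 by simp
  next
    case 2
    then have "\<not> j < r - 1" "j \<noteq> r" using assms(2) by auto
    then show ?thesis unfolding radau_def * using 2 by simp
  next
    case 3
    then have "\<not> j < r - 1" by simp
    then show ?thesis unfolding radau_def * using 3 by simp
  qed
qed

text \<open>
What is left of the projection error after the contribution of the Legendre coefficient of order \<open>r\<close>
has been removed.
\<close>

definition radau_defect :: "nat \<Rightarrow> (real \<Rightarrow> 'a::banach) \<Rightarrow> real \<Rightarrow> 'a"
  where "radau_defect r v s =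
    radau r v s - v s + (poly (lpol r) s - poly (lpol (r - 1)) s) *\<^sub>R lcoef r v"

lemma radau_defect_add:
  assumes "continuous_on {a..b} v" "continuous_on {a..b} w"
  shows "radau_defect r (\<lambda>s. v s + w s) s = radau_defect r v s + radau_defect r w s"
  by (simp add: radau_defect_def radau_add lcoef_add assms algebra_simps)

lemma radau_defect_cong:
  assumes "\<And>s. s \<in> {a..b} \<Longrightarrow> v s = w s" "s \<in> {a..b}"
  shows "radau_defect r v s = radau_defect r w s"
  using assms radau_cong [of v w] lcoef_cong [of v w] by (simp add: radau_defect_def)

lemma radau_defect_vpoly:
  assumes "vpoly (r + 1) v" "r \<ge> 1"
  shows "radau_defect r v s = 0"
proof -
  obtain d where "\<And>s. v s = (\<Sum>j<r + 1. poly (lpol j) s *\<^sub>R d j)"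
    using vpoly_lpol_expansion [OF assms(1)] by blast
  then have d: "v = (\<lambda>s. \<Sum>j<r + 1. poly (lpol j) s *\<^sub>R d j)" by blast
  have *: "radau_defect r (\<lambda>s. poly (lpol j) s *\<^sub>R d j) s = 0" if "j < r + 1" for j
    using that assms(2) by (auto simp: radau_defect_def radau_lpol lcoef_lpol algebra_simps)
  have "radau_defect r (\<lambda>s. \<Sum>j<m. poly (lpol j) s *\<^sub>R d j) s = 0" if "m \<le> r + 1" for m
    using that
  proof (induction m)
    case 0
    show ?case by (simp add: radau_defect_def radau_def l2proj_def lcoef_def)
  next
    case (Suc m)
    then show ?case
      unfolding sum.lessThan_Suc
      by (subst radau_defect_add) (auto simp: * intro!: continuous_intros)
  qed
  then show ?thesis by (simp only: d order_refl)
qed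

end

definition radau_bound :: "nat \<Rightarrow> real"
  where "radau_bound r = l2proj_bound (r - 1) + legendre_bound (r - 1) * (1 + l2proj_bound (r - 1))"

lemma radau_bound_nonneg: "0 \<le> radau_bound r"
  by (simp add: radau_bound_def legendre_bound_nonneg l2proj_bound_nonneg)

definition radau_defect_bound :: "nat \<Rightarrow> real"
  where "radau_defect_bound r = radau_bound r + 1
    + (legendre_bound r + legendre_bound (r - 1)) * ((2 * real r + 1) * legendre_bound r)"

lemma radau_defect_bound_nonneg: "0 \<le> radau_defect_bound r"
  by (simp add: radau_defect_bound_def legendre_bound_nonneg radau_bound_nonneg)

context time_step
begin

lemma norm_radau_le:
  assumes v: "continuous_on {a..b} v" and s: "s \<in> {a..b}" and B: "\<And>s. s \<in> {a..b} \<Longrightarrow> norm (v s) \<le> B"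
  shows "norm (radau r v s) \<le> radau_bound r * B"
proof -
  let ?P = "l2proj (r - 1) v"
  have b: "b \<in> {a..b}" using ab by simp
  have "norm (v b - ?P b) \<le> B + l2proj_bound (r - 1) * B"
    using B [OF b] norm_l2proj_le [OF v b B, of "r - 1"] norm_triangle_ineq4 [of "v b" "?P b"] by simp
  then have "norm (poly (lpol (r - 1)) s *\<^sub>R (v b - ?P b))
      \<le> legendre_bound (r - 1) * (B + l2proj_bound (r - 1) * B)"
    unfolding norm_scaleR real_norm_def
    by (intro mult_mono lpol_bound s legendre_bound_nonneg) auto
  moreover have "norm (?P s) \<le> l2proj_bound (r - 1) * B" by (rule norm_l2proj_le [OF v s B])
  ultimately show ?thesis
    using norm_triangle_ineq [of "?P s" "poly (lpol (r - 1)) s *\<^sub>R (v b - ?P b)"]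
    by (simp add: radau_def radau_bound_def algebra_simps)
qed

lemma norm_radau_defect_le:
  assumes v: "continuous_on {a..b} v" and s: "s \<in> {a..b}" and B: "\<And>s. s \<in> {a..b} \<Longrightarrow> norm (v s) \<le> B"
  shows "norm (radau_defect r v s) \<le> radau_defect_bound r * B"
proof -
  let ?M = "legendre_bound"
  have "avg (\<lambda>s. norm (v s)) \<le> B"
    using v B by (intro avg_le) (auto intro!: continuous_intros)
  then have "(2 * real r + 1) * ?M r * avg (\<lambda>s. norm (v s)) \<le> (2 * real r + 1) * ?M r * B"
    by (intro mult_left_mono) (auto simp: legendre_bound_nonneg)
  then have "norm (lcoef r v) \<le> (2 * real r + 1) * ?M r * B"
    using lcoef_bound_avg [OF v, of r] by (rule order_trans [rotated])
  moreover have "\<bar>poly (lpol r) s - poly (lpol (r - 1)) s\<bar> \<le> ?M r + ?M (r - 1)"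
    using lpol_bound [OF s, of r] lpol_bound [OF s, of "r - 1"] by simp
  ultimately have "norm ((poly (lpol r) s - poly (lpol (r - 1)) s) *\<^sub>R lcoef r v)
      \<le> (?M r + ?M (r - 1)) * ((2 * real r + 1) * ?M r * B)"
    unfolding norm_scaleR real_norm_def by (intro mult_mono) (auto simp: legendre_bound_nonneg)
  moreover have "norm (radau r v s - v s) \<le> radau_bound r * B + B"
    using norm_radau_le [OF v s B, of r] B [OF s] norm_triangle_ineq4 [of "radau r v s" "v s"] by simp
  ultimately show ?thesis
    using norm_triangle_ineq [of "radau r v s - v s" "(poly (lpol r) s - poly (lpol (r - 1)) s) *\<^sub>R lcoef r v"]
    by (simp add: radau_defect_def radau_defect_bound_def algebra_simps)
qed

end


section \<open>Stability of a single step\<close>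

lemma bounded_bilinear_inner_image:
  "bounded_bilinear (\<lambda>x y. blinfun_apply \<iota> x \<bullet> blinfun_apply \<iota> y)"
  by (intro bounded_bilinear.comp [OF bounded_bilinear_inner] blinfun.bounded_linear_right)

lemma bounded_bilinear_form:
  fixes A :: "'h::real_normed_vector \<Rightarrow>\<^sub>L ('h \<Rightarrow>\<^sub>L real)"
  shows "bounded_bilinear (\<lambda>x y. blinfun_apply (blinfun_apply A x) y)"
  by (intro bounded_bilinear.comp1 [OF bounded_bilinear_blinfun_apply] blinfun.bounded_linear_right)

context time_step
begin

lemma integral_inner_le:
  assumes "continuous_on {a..b} g" "continuous_on {a..b} x"
    and G: "\<And>s. s \<in> {a..b} \<Longrightarrow> norm (g s) \<le> G" and B: "\<And>s. s \<in> {a..b} \<Longrightarrow> norm (x s) \<le> B"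
  shows "integral {a..b} (\<lambda>s. g s \<bullet> x s) \<le> (b - a) * G * B"
proof -
  have "integral {a..b} (\<lambda>s. g s \<bullet> x s) \<le> integral {a..b} (\<lambda>s. G * B)"
  proof (intro integral_le integrable_continuous_real continuous_intros assms)
    fix s assume s: "s \<in> {a..b}"
    have "g s \<bullet> x s \<le> norm (g s) * norm (x s)" by (rule norm_cauchy_schwarz)
    also have "\<dots> \<le> G * B"
      using G [OF s] B [OF s] by (intro mult_mono) (auto intro: order_trans [OF norm_ge_zero])
    finally show "g s \<bullet> x s \<le> G * B" .
  qed
  then show ?thesis using ab by (simp add: mult_ac)
qed

lemma integral_inner_derivative:
  assumes v: "\<And>s. s \<in> {a..b} \<Longrightarrow> (v has_vector_derivative v' s) (at s within {a..b})"
    and w: "\<And>s. s \<in> {a..b} \<Longrightarrow> (w has_vector_derivative w' s) (at s within {a..b})"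
  shows "((\<lambda>s. v' s \<bullet> w s + v s \<bullet> w' s) has_integral (v b \<bullet> w b - v a \<bullet> w a)) {a..b}"
proof (rule fundamental_theorem_of_calculus)
  fix s assume s: "s \<in> {a..b}"
  show "((\<lambda>s. v s \<bullet> w s) has_vector_derivative v' s \<bullet> w s + v s \<bullet> w' s) (at s within {a..b})"
    using bounded_bilinear.has_vector_derivative [OF bounded_bilinear_inner v [OF s] w [OF s]]
    by (simp add: add.commute)
qed (use ab in simp)

text \<open>
The weight \<open>\<phi>(s) = (b - s) / (b - a)\<close> decreases from \<open>1\<close> to \<open>0\<close>. Integrating the derivative of
\<open>\<phi>(s) \<parallel>v(s)\<parallel>\<^sup>2\<close> therefore gives the mean square of \<open>v\<close>, from the slope of \<open>\<phi>\<close>, and a boundary term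
at \<open>a\<close> only.
\<close>

lemma weighted_energy_identity:
  assumes v: "\<And>s. s \<in> {a..b} \<Longrightarrow> (v has_vector_derivative v' s) (at s within {a..b})"
    and v': "continuous_on {a..b} v'"
  shows "integral {a..b} (\<lambda>s. v' s \<bullet> ((b - s) / (b - a)) *\<^sub>R v s)
     = (avg (\<lambda>s. (norm (v s))\<^sup>2) - (norm (v a))\<^sup>2) / 2"
proof -
  let ?\<phi> = "\<lambda>s. (b - s) / (b - a)"
  have cv: "continuous_on {a..b} v" by (rule continuous_on_vector_derivative) (rule v)
  have "((\<lambda>s. v' s \<bullet> ?\<phi> s *\<^sub>R v s + v s \<bullet> (?\<phi> s *\<^sub>R v' s + (- 1 / (b - a)) *\<^sub>R v s)) has_integral
      (v b \<bullet> ?\<phi> b *\<^sub>R v b - v a \<bullet> ?\<phi> a *\<^sub>R v a)) {a..b}"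
    by (intro integral_inner_derivative v has_vector_derivative_scaleR DERIV_cdivide)
      (auto intro!: derivative_eq_intros)
  then have "- (norm (v a))\<^sup>2
      = integral {a..b} (\<lambda>s. v' s \<bullet> ?\<phi> s *\<^sub>R v s + v s \<bullet> (?\<phi> s *\<^sub>R v' s + (- 1 / (b - a)) *\<^sub>R v s))"
    using ab by (simp add: integral_unique power2_norm_eq_inner)
  also have "\<dots> = integral {a..b} (\<lambda>s. 2 * (v' s \<bullet> ?\<phi> s *\<^sub>R v s) - 1 / (b - a) * (norm (v s))\<^sup>2)"
    by (intro integral_cong)
       (simp add: inner_add_right inner_diff_right inner_commute power2_norm_eq_inner)
  also have "\<dots> = integral {a..b} (\<lambda>s. 2 * (v' s \<bullet> ?\<phi> s *\<^sub>R v s))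
      - integral {a..b} (\<lambda>s. 1 / (b - a) * (norm (v s))\<^sup>2)"
    using cv v' ab by (intro integral_diff integrable_continuous_real continuous_intros) auto
  also have "\<dots> = 2 * integral {a..b} (\<lambda>s. v' s \<bullet> ?\<phi> s *\<^sub>R v s) - avg (\<lambda>s. (norm (v s))\<^sup>2)"
    by (simp add: avg_def del: inner_scaleR_right)
  finally show ?thesis by (simp del: inner_scaleR_right)
qed

end

definition stability_factor :: "nat \<Rightarrow> real"
  where "stability_factor r = (l2proj_bound r)\<^sup>2 * (1 + 2 * l2proj_bound r)"

definition stability_const :: "nat \<Rightarrow> real"
  where "stability_const r = 2 * (stability_factor r + (stability_factor r)\<^sup>2)"

lemma stability_factor_nonneg: "0 \<le> stability_factor r"
  by (simp add: stability_factor_def l2proj_bound_nonneg)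

lemma stability_const_nonneg: "0 \<le> stability_const r"
  by (simp add: stability_const_def stability_factor_nonneg)

text \<open>
The supremum \<open>S\<close> is bounded by the initial value \<open>n\<close>, whose square is in turn bounded by \<open>S\<close> to the
first power. By the inequality between the means, \<open>K n \<le> K\<^sup>2 D + S / 2\<close>, and half of \<open>S\<close> is absorbed.
\<close>

lemma absorb_half:
  fixes S D K n :: real
  assumes S: "S \<le> K * (n + D)" and n: "n\<^sup>2 \<le> 2 * D * S"
    and nonneg: "0 \<le> K" "0 \<le> D" "0 \<le> S" "0 \<le> n"
  shows "S \<le> 2 * (K + K\<^sup>2) * D"
proof -
  have "(K * n)\<^sup>2 \<le> K\<^sup>2 * (2 * D * S)"
    unfolding power_mult_distrib by (intro mult_left_mono n) simp
  also have "\<dots> \<le> (K\<^sup>2 * D + S / 2)\<^sup>2"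
    using sum_squares_bound [of "K\<^sup>2 * D" "S / 2"] zero_le_power2 [of "K\<^sup>2 * D - S / 2"]
    by (simp add: power2_eq_square algebra_simps)
  finally have "K * n \<le> K\<^sup>2 * D + S / 2"
    by (rule power2_le_imp_le) (use nonneg in simp)
  then show ?thesis using S by (simp add: algebra_simps)
qed

context time_step
begin

text \<open>
The constant is independent of \<open>A\<close> and of the step because the term with \<open>A\<close> is nonnegative, and can be
dropped, in both tests: with \<open>X = \<theta>\<close>, which bounds the square of \<open>\<theta> a\<close> by the data times the supremum of
\<open>\<theta>\<close>, and with the projection of \<open>\<phi> \<theta>\<close>, where \<open>\<phi>(s) = (b - s) / (b - a)\<close>, which bounds the mean square
of \<open>\<theta>\<close> by the weighted energy identity.
\<close>

lemma dG_step_stability: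
  fixes \<iota> :: "'h::{real_inner,banach} \<Rightarrow>\<^sub>L 'l::{real_inner,banach}"
    and A :: "'h \<Rightarrow>\<^sub>L ('h \<Rightarrow>\<^sub>L real)"
  assumes pos: "\<And>x. 0 \<le> A x x"
    and \<theta>: "vpoly r \<theta>" "vpoly r \<theta>'"
      "\<And>s. s \<in> {a..b} \<Longrightarrow> (\<theta> has_vector_derivative \<theta>' s) (at s within {a..b})"
    and g: "continuous_on {a..b} g" "\<And>s. s \<in> {a..b} \<Longrightarrow> norm (g s) \<le> G"
    and eq: "\<And>X. vpoly r X \<Longrightarrow>
        \<iota> (\<theta> a) \<bullet> \<iota> (X a) + integral {a..b} (\<lambda>s. \<iota> (\<theta>' s) \<bullet> \<iota> (X s) + A (\<theta> s) (X s))
        = e \<bullet> \<iota> (X a) + integral {a..b} (\<lambda>s. g s \<bullet> \<iota> (X s))"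
    and s: "s \<in> {a..b}"
  shows "norm (\<iota> (\<theta> s)) \<le> stability_const r * (norm e + (b - a) * G)"
proof -
  define v where "v s = \<iota> (\<theta> s)" for s
  define v' where "v' s = \<iota> (\<theta>' s)" for s
  define D where "D = norm e + (b - a) * G"
  define \<phi> where "\<phi> s = (b - s) / (b - a)" for s
  define X where "X = l2proj r (\<lambda>s. \<phi> s *\<^sub>R \<theta> s)"
  define x where "x s = \<iota> (X s)" for s
  let ?\<Lambda> = "l2proj_bound r" and ?K = "stability_factor r"
  have a: "a \<in> {a..b}" using ab by simp
  have X: "vpoly r X" unfolding X_def by (rule vpoly_l2proj)
  have vp: "vpoly r v" "vpoly r v'" "vpoly r x"
    unfolding v_def v'_def x_def by (rule \<theta>(1,2) X vpoly_linear [OF _ blinfun.bounded_linear_right])+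
  note cont [continuous_intros] = vpoly_continuous_on [OF \<theta>(1)] vpoly_continuous_on [OF \<theta>(2)]
    vpoly_continuous_on [OF X] vp [THEN vpoly_continuous_on] g(1)
  have form_cont [continuous_intros]: "continuous_on {a..b} (\<lambda>s. A (Y s) (Z s))"
    if "continuous_on {a..b} Y" "continuous_on {a..b} Z" for Y Z
    using that by (intro bounded_bilinear.continuous_on [OF bounded_bilinear_form])
  have \<phi>_cont [continuous_intros]: "continuous_on {a..b} \<phi>"
    using ab unfolding \<phi>_def by (intro continuous_intros) auto
  have \<phi>01: "0 \<le> \<phi> s" "\<phi> s \<le> 1" if "s \<in> {a..b}" for s
    using that ab by (auto simp: \<phi>_def divide_simps)
  have v_deriv: "(v has_vector_derivative v' s) (at s within {a..b})" if "s \<in> {a..b}" for s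
    unfolding v_def v'_def
    by (rule bounded_linear.has_vector_derivative [OF blinfun.bounded_linear_right \<theta>(3) [OF that]])
  have G: "0 \<le> G" by (rule order_trans [OF norm_ge_zero g(2) [OF a]])
  have D: "0 \<le> D" using G ab by (simp add: D_def)
  have "\<exists>z\<in>{a..b}. \<forall>s\<in>{a..b}. norm (v s) \<le> norm (v z)"
    using a by (intro continuous_attains_sup continuous_intros) auto
  then obtain z where z: "z \<in> {a..b}" and max: "\<And>s. s \<in> {a..b} \<Longrightarrow> norm (v s) \<le> norm (v z)"
    by blast
  define S where "S = norm (v z)"
  have S: "norm (v s) \<le> S" if "s \<in> {a..b}" for s using max [OF that] by (simp add: S_def)
  have "0 \<le> S" by (simp add: S_def)

  have energy: "(norm (v a))\<^sup>2 \<le> 2 * D * S"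
  proof -
    have "((\<lambda>s. v' s \<bullet> v s + v s \<bullet> v' s) has_integral (v b \<bullet> v b - v a \<bullet> v a)) {a..b}"
      by (intro integral_inner_derivative v_deriv)
    from integral_unique [OF this]
    have "integral {a..b} (\<lambda>s. 2 * (v' s \<bullet> v s)) = (norm (v b))\<^sup>2 - (norm (v a))\<^sup>2"
      by (simp add: power2_norm_eq_inner inner_commute)
    then have 1: "integral {a..b} (\<lambda>s. v' s \<bullet> v s) = ((norm (v b))\<^sup>2 - (norm (v a))\<^sup>2) / 2"
      by simp
    have 2: "0 \<le> integral {a..b} (\<lambda>s. A (\<theta> s) (\<theta> s))"
      by (intro integral_nonneg integrable_continuous_real continuous_intros pos)
    have "integral {a..b} (\<lambda>s. v' s \<bullet> v s + A (\<theta> s) (\<theta> s))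
        = integral {a..b} (\<lambda>s. v' s \<bullet> v s) + integral {a..b} (\<lambda>s. A (\<theta> s) (\<theta> s))"
      by (intro integral_add integrable_continuous_real continuous_intros)
    then have "v a \<bullet> v a + (integral {a..b} (\<lambda>s. v' s \<bullet> v s) + integral {a..b} (\<lambda>s. A (\<theta> s) (\<theta> s)))
        = e \<bullet> v a + integral {a..b} (\<lambda>s. g s \<bullet> v s)"
      using eq [OF \<theta>(1)] by (simp add: v_def v'_def)
    with 1 2 have "(norm (v a))\<^sup>2 + ((norm (v b))\<^sup>2 - (norm (v a))\<^sup>2) / 2
        \<le> e \<bullet> v a + integral {a..b} (\<lambda>s. g s \<bullet> v s)"
      unfolding power2_norm_eq_inner by linarith
    moreover have "e \<bullet> v a \<le> norm e * S"
      using norm_cauchy_schwarz [of e "v a"] mult_left_mono [OF S [OF a] norm_ge_zero [of e]] by simp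
    moreover have "integral {a..b} (\<lambda>s. g s \<bullet> v s) \<le> (b - a) * G * S"
      by (intro integral_inner_le continuous_intros g S)
    moreover have "x + y \<le> 2 * (p + q)" if "x + (y - x) / 2 \<le> i + j" "i \<le> p" "j \<le> q"
      for x y i j p q :: real
      using that by (simp add: field_simps)
    ultimately have "(norm (v a))\<^sup>2 + (norm (v b))\<^sup>2 \<le> 2 * (norm e * S + (b - a) * G * S)"
      by blast
    also have "\<dots> = 2 * D * S" by (simp add: D_def algebra_simps)
    finally show ?thesis using zero_le_power2 [of "norm (v b)"] by linarith
  qed

  have "S \<le> ?K * (norm (v a) + D)"
  proof -
    have x_eq: "x s = l2proj r (\<lambda>s. \<phi> s *\<^sub>R v s) s" for s
    proof -
      have "x s = l2proj r (\<lambda>s. \<iota> (\<phi> s *\<^sub>R \<theta> s)) s"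
        unfolding x_def X_def
        by (intro l2proj_linear [symmetric] continuous_intros blinfun.bounded_linear_right)
      then show ?thesis by (simp add: v_def blinfun.scaleR_right)
    qed
    have x_le: "norm (x s) \<le> ?\<Lambda> * S" if "s \<in> {a..b}" for s
      unfolding x_eq
    proof (intro norm_l2proj_le continuous_intros that)
      fix s assume "s \<in> {a..b}"
      then show "norm (\<phi> s *\<^sub>R v s) \<le> S"
        using \<phi>01 S mult_mono [of "\<phi> s" 1 "norm (v s)" S] by simp
    qed
    \<comment> \<open>\<open>v'\<close> and \<open>\<theta>\<close> are polynomials with \<open>r\<close> coefficients, so against them the projection is invisible\<close>
    have "integral {a..b} (\<lambda>s. v' s \<bullet> x s) = integral {a..b} (\<lambda>s. v' s \<bullet> \<phi> s *\<^sub>R v s)"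
    proof (rule integral_bilinear_eq_if_lcoef_eq [OF bounded_bilinear_inner vp(2)])
      show "lcoef j x = lcoef j (\<lambda>s. \<phi> s *\<^sub>R v s)" if "j < r" for j
        using that by (simp add: x_eq [abs_def] lcoef_l2proj)
    qed (intro continuous_intros)+
    also have "\<dots> = (avg (\<lambda>s. (norm (v s))\<^sup>2) - (norm (v a))\<^sup>2) / 2"
      unfolding \<phi>_def by (intro weighted_energy_identity v_deriv continuous_intros)
    finally have 1: "integral {a..b} (\<lambda>s. v' s \<bullet> x s) = \<dots>" .
    have "integral {a..b} (\<lambda>s. A (\<theta> s) (X s)) = integral {a..b} (\<lambda>s. A (\<theta> s) (\<phi> s *\<^sub>R \<theta> s))"
      using integral_bilinear_eq_if_lcoef_eq [OF bounded_bilinear_form \<theta>(1), of X "\<lambda>s. \<phi> s *\<^sub>R \<theta> s"]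
      by (simp add: continuous_intros X_def lcoef_l2proj vpoly_continuous_on [OF vpoly_l2proj])
    also have "\<dots> \<ge> 0"
      by (intro integral_nonneg integrable_continuous_real continuous_intros)
         (simp add: blinfun.scaleR_right \<phi>01 pos)
    finally have 2: "0 \<le> integral {a..b} (\<lambda>s. A (\<theta> s) (X s))" .
    have "integral {a..b} (\<lambda>s. v' s \<bullet> x s + A (\<theta> s) (X s))
        = integral {a..b} (\<lambda>s. v' s \<bullet> x s) + integral {a..b} (\<lambda>s. A (\<theta> s) (X s))"
      by (intro integral_add integrable_continuous_real continuous_intros)
    then have "v a \<bullet> x a + (integral {a..b} (\<lambda>s. v' s \<bullet> x s) + integral {a..b} (\<lambda>s. A (\<theta> s) (X s)))
        = e \<bullet> x a + integral {a..b} (\<lambda>s. g s \<bullet> x s)"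
      using eq [OF X] by (simp add: v_def v'_def x_def)
    with 1 2 have "v a \<bullet> x a + (avg (\<lambda>s. (norm (v s))\<^sup>2) - (norm (v a))\<^sup>2) / 2
        \<le> e \<bullet> x a + integral {a..b} (\<lambda>s. g s \<bullet> x s)"
      by linarith
    moreover have "e \<bullet> x a \<le> norm e * (?\<Lambda> * S)"
      using norm_cauchy_schwarz [of e "x a"] mult_left_mono [OF x_le [OF a] norm_ge_zero [of e]] by simp
    moreover have "- (v a \<bullet> x a) \<le> norm (v a) * (?\<Lambda> * S)"
      using norm_cauchy_schwarz [of "- v a" "x a"] mult_left_mono [OF x_le [OF a] norm_ge_zero [of "v a"]]
      by simp
    moreover have "integral {a..b} (\<lambda>s. g s \<bullet> x s) \<le> (b - a) * G * (?\<Lambda> * S)"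
      by (intro integral_inner_le continuous_intros g x_le)
    moreover have "(norm (v a))\<^sup>2 \<le> (norm (v a) + D) * S"
      unfolding power2_eq_square using S [OF a] D \<open>0 \<le> S\<close> by (intro mult_mono) auto
    moreover have "y \<le> m + 2 * (p + q + l)"
      if "n + (y - x) / 2 \<le> i + j" "i \<le> p" "- n \<le> q" "j \<le> l" "x \<le> m" for x y i j l m n p q :: real
      using that by (simp add: field_simps)
    ultimately have "avg (\<lambda>s. (norm (v s))\<^sup>2) \<le> (norm (v a) + D) * S
        + 2 * (norm e * (?\<Lambda> * S) + norm (v a) * (?\<Lambda> * S) + (b - a) * G * (?\<Lambda> * S))"
      by blast
    also have "\<dots> = (1 + 2 * ?\<Lambda>) * (norm (v a) + D) * S"
      by (simp add: D_def algebra_simps)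
    finally have avg_le: "avg (\<lambda>s. (norm (v s))\<^sup>2) \<le> (1 + 2 * ?\<Lambda>) * (norm (v a) + D) * S" .
    \<comment> \<open>the inverse estimate: the supremum of the polynomial \<open>v\<close> is bounded by its mean square\<close>
    have "S = norm (l2proj r v z)" by (simp add: S_def l2proj_vpoly [OF vp(1)])
    also have "\<dots> \<le> ?\<Lambda> * avg (\<lambda>s. norm (v s))"
      by (intro norm_l2proj_le_avg continuous_intros z)
    finally have "S\<^sup>2 \<le> (?\<Lambda> * avg (\<lambda>s. norm (v s)))\<^sup>2"
      using \<open>0 \<le> S\<close> by (rule power_mono)
    also have "\<dots> \<le> ?\<Lambda>\<^sup>2 * avg (\<lambda>s. (norm (v s))\<^sup>2)"
      unfolding power_mult_distrib by (intro mult_left_mono avg_square_le continuous_intros) simp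
    also have "\<dots> \<le> ?\<Lambda>\<^sup>2 * ((1 + 2 * ?\<Lambda>) * (norm (v a) + D) * S)"
      by (intro mult_left_mono avg_le) simp
    finally have "S * S \<le> (?K * (norm (v a) + D)) * S"
      by (simp add: stability_factor_def power2_eq_square mult_ac)
    then show ?thesis
      using \<open>0 \<le> S\<close> D by (cases "S = 0") (auto simp: stability_factor_nonneg)
  qed
  then have "S \<le> 2 * (?K + ?K\<^sup>2) * D"
    by (rule absorb_half) (auto simp: energy stability_factor_nonneg D \<open>0 \<le> S\<close>)
  then show ?thesis
    using S [OF s] by (simp add: stability_const_def D_def v_def)
qed

end


section \<open>Taylor expansion by iterated integrals\<close>

lemma vpoly_antiderivative:
  fixes X :: "real \<Rightarrow> 'a::real_normed_vector"
  assumes "vpoly m X"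
  shows "\<exists>Y. vpoly (Suc m) Y \<and> (\<forall>s S. (Y has_vector_derivative X s) (at s within S))"
proof -
  obtain c where c: "\<And>s. X s = (\<Sum>j<m. s ^ j *\<^sub>R c j)"
    using assms by (auto simp: vpoly_def)
  define Y where "Y s = (\<Sum>j<m. s ^ Suc j *\<^sub>R (c j /\<^sub>R real (Suc j)))" for s
  have "vpoly (Suc m) Y"
    unfolding Y_def by (intro vpoly_sum vpoly_power) auto
  moreover have "((\<lambda>s. s ^ Suc j *\<^sub>R (c j /\<^sub>R real (Suc j))) has_vector_derivative s ^ j *\<^sub>R c j) (at s within S)"
    for j s S
  proof -
    have "((\<lambda>s. s ^ Suc j) has_field_derivative real (Suc j) * s ^ j) (at s within S)"
      using DERIV_power_Suc [OF DERIV_ident, where n = j] by simp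
    from has_vector_derivative_scaleR [OF this has_vector_derivative_const, of "c j /\<^sub>R real (Suc j)"]
    moreover have "(real (Suc j) * s ^ j) *\<^sub>R (c j /\<^sub>R real (Suc j)) = s ^ j *\<^sub>R c j"
      by (simp add: field_simps del: of_nat_Suc)
    ultimately show ?thesis by (simp only: scaleR_zero_right add_0_left)
  qed
  then have "(Y has_vector_derivative X s) (at s within S)" for s S
    unfolding Y_def c by (intro has_vector_derivative_sum)
  ultimately show ?thesis by (intro exI [of _ Y]) simp
qed

lemma vpoly_const: "vpoly (Suc m) (\<lambda>s. c)"
  using vpoly_power [of 0 "Suc m" c] by simp

lemma vpoly_shift:
  assumes "vpoly m X"
  shows "vpoly m (\<lambda>s. X (s + d))"
proof -
  obtain c where c: "\<And>s. X s = (\<Sum>j<m. s ^ j *\<^sub>R c j)"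
    using assms by (auto simp: vpoly_def)
  have "vpoly m (\<lambda>s. \<Sum>j<m. poly ([:d, 1:] ^ j) s *\<^sub>R c j)"
    by (intro vpoly_sum vpoly_poly) (simp add: degree_power_eq)
  then show ?thesis by (simp add: c add.commute)
qed

text \<open>
A polynomial with values in a subspace has its coefficients there. The combination
\<open>p(2 s) - 2 ^ m p(s)\<close> removes the term of order \<open>m\<close> and multiplies the others by nonzero numbers, so
induction applies. The argument is purely algebraic, with a view to the range of a compact embedding,
which is in general not closed.
\<close>

lemma subspace_poly_coeffs:
  fixes c :: "nat \<Rightarrow> 'a::real_vector"
  assumes V: "subspace V" and "d > 0"
    and "\<And>s. s \<in> {0<..d} \<Longrightarrow> (\<Sum>j<m. s ^ j *\<^sub>R c j) \<in> V"
    and "j < m"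
  shows "c j \<in> V"
  using assms(2-)
proof (induction m arbitrary: c d j)
  case (Suc m)
  let ?p = "\<lambda>s. \<Sum>j<Suc m. s ^ j *\<^sub>R c j"
  have lower: "c i \<in> V" if "i < m" for i
  proof -
    have "(2 ^ i - 2 ^ m :: real) *\<^sub>R c i \<in> V"
    proof (rule Suc.IH [where d = "d / 2" and c = "\<lambda>i. (2 ^ i - 2 ^ m :: real) *\<^sub>R c i"])
      fix s :: real assume "s \<in> {0<..d / 2}"
      then have "?p (2 * s) - 2 ^ m *\<^sub>R ?p s \<in> V"
        by (intro subspace_diff subspace_scale V Suc.prems) auto
      also have "?p (2 * s) - 2 ^ m *\<^sub>R ?p s = (\<Sum>j<Suc m. s ^ j *\<^sub>R ((2 ^ j - 2 ^ m :: real) *\<^sub>R c j))"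
        unfolding scaleR_sum_right sum_subtractf [symmetric]
        by (intro sum.cong) (auto simp: power_mult_distrib algebra_simps)
      finally show "(\<Sum>j<m. s ^ j *\<^sub>R ((2 ^ j - 2 ^ m :: real) *\<^sub>R c j)) \<in> V" by simp
    qed (use Suc.prems that in auto)
    then have "inverse (2 ^ i - 2 ^ m :: real) *\<^sub>R (2 ^ i - 2 ^ m :: real) *\<^sub>R c i \<in> V"
      by (rule subspace_scale [OF V])
    with that show ?thesis by simp
  qed
  show ?case
  proof (cases "j = m")
    case True
    have "?p d - (\<Sum>j<m. d ^ j *\<^sub>R c j) \<in> V"
      using Suc.prems(1) by (intro subspace_diff subspace_sum subspace_scale V lower Suc.prems(2)) auto
    then have "inverse (d ^ m) *\<^sub>R d ^ m *\<^sub>R c m \<in> V"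
      by (intro subspace_scale [OF V, of "d ^ m *\<^sub>R c m"]) simp
    with Suc.prems(1) True show ?thesis by simp
  qed (use lower Suc.prems(3) in auto)
qed simp

text \<open>
The interval of values excludes \<open>a\<close>: the solution of an evolution equation need not a priori belong to
the smaller space at the initial time.
\<close>

lemma vpoly_lift_range:
  fixes \<iota> :: "'a::real_normed_vector \<Rightarrow>\<^sub>L 'b::real_normed_vector"
  assumes "vpoly m q" "a < b" "\<And>s. s \<in> {a<..b} \<Longrightarrow> q s \<in> range (blinfun_apply \<iota>)"
  shows "\<exists>Q. vpoly m Q \<and> (\<forall>s. blinfun_apply \<iota> (Q s) = q s)"
proof -
  obtain c where c: "\<And>s. q (s + a) = (\<Sum>j<m. s ^ j *\<^sub>R c j)"
    using vpoly_shift [OF assms(1), of a] by (auto simp: vpoly_def)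
  have "c j \<in> range (blinfun_apply \<iota>)" if "j < m" for j
  proof (rule subspace_poly_coeffs [OF _ _ _ that])
    show "subspace (range (blinfun_apply \<iota>))"
      by (rule linear_subspace_image [OF bounded_linear.linear [OF blinfun.bounded_linear_right] subspace_UNIV])
    show "(\<Sum>j<m. s ^ j *\<^sub>R c j) \<in> range (blinfun_apply \<iota>)" if "s \<in> {0<..b - a}" for s
      using assms(3) [of "s + a"] that by (simp flip: c)
  qed (use assms(2) in simp)
  then have "\<forall>j. \<exists>x. j < m \<longrightarrow> c j = \<iota> x" by blast
  then obtain h where h: "\<And>j. j < m \<Longrightarrow> c j = \<iota> (h j)" by metis
  define Y where "Y s = (\<Sum>j<m. s ^ j *\<^sub>R h j)" for s
  have "vpoly m Y" by (rule vpolyI) (simp add: Y_def)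
  then have "vpoly m (\<lambda>s. Y (s + - a))" by (rule vpoly_shift)
  moreover have "\<iota> (Y (s + - a)) = q s" for s
    using c [of "s - a"] by (simp add: Y_def blinfun.sum_right blinfun.scaleR_right h)
  ultimately show ?thesis by blast
qed

context time_step
begin

text \<open>
The \<open>m\<close>-fold iterate of this operator gives the remainder in Taylor's formula. As it commutes with
bounded linear maps, the remainder can be formed in \<open>\<H>\<close>, in \<open>\<L>\<close>, or in the dual of \<open>\<H>\<close>.
\<close>

definition volterra :: "(real \<Rightarrow> 'a::banach) \<Rightarrow> real \<Rightarrow> 'a"
  where "volterra v s = integral {a..s} v"

lemma volterra_continuous_on:
  assumes "continuous_on {a..b} v"
  shows "continuous_on {a..b} (volterra v)"
  unfolding volterra_def by (intro indefinite_integral_continuous_1 integrable_continuous_real assms)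

lemma volterra_iterated_continuous_on:
  assumes "continuous_on {a..b} v"
  shows "continuous_on {a..b} ((volterra ^^ m) v)"
  using assms by (induction m) (auto intro: volterra_continuous_on)

lemma volterra_cong:
  assumes "\<And>s. s \<in> {a..b} \<Longrightarrow> v s = w s" "s \<in> {a..b}"
  shows "volterra v s = volterra w s"
  unfolding volterra_def using assms by (intro integral_cong) auto

lemma volterra_iterated_cong:
  assumes "\<And>s. s \<in> {a..b} \<Longrightarrow> v s = w s" "s \<in> {a..b}"
  shows "(volterra ^^ m) v s = (volterra ^^ m) w s"
  using assms(2) by (induction m arbitrary: s) (auto intro: assms(1) volterra_cong)

lemma volterra_linear:
  assumes "continuous_on {a..b} v" "bounded_linear f" "s \<in> {a..b}"
  shows "volterra (\<lambda>s. f (v s)) s = f (volterra v s)"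
proof -
  have "v integrable_on {a..s}"
    using assms(1,3) by (intro integrable_continuous_real continuous_on_subset [OF assms(1)]) auto
  from integral_linear [OF this assms(2)] show ?thesis by (simp add: volterra_def o_def)
qed

lemma volterra_iterated_linear:
  assumes "continuous_on {a..b} v" "bounded_linear f" "s \<in> {a..b}"
  shows "(volterra ^^ m) (\<lambda>s. f (v s)) s = f ((volterra ^^ m) v s)"
  using assms(3)
proof (induction m arbitrary: s)
  case (Suc m)
  have "(volterra ^^ Suc m) (\<lambda>s. f (v s)) s = volterra (\<lambda>s. f ((volterra ^^ m) v s)) s"
    using Suc by (auto intro: volterra_cong)
  also have "\<dots> = f ((volterra ^^ Suc m) v s)"
    unfolding funpow.simps o_apply
    by (rule volterra_linear [OF volterra_iterated_continuous_on [OF assms(1)] assms(2) Suc.prems])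
  finally show ?case .
qed simp

lemma norm_volterra_iterated_le:
  assumes "continuous_on {a..b} v" "\<And>s. s \<in> {a..b} \<Longrightarrow> norm (v s) \<le> B" "s \<in> {a..b}"
  shows "norm ((volterra ^^ m) v s) \<le> (b - a) ^ m * B"
  using assms(3)
proof (induction m arbitrary: s)
  case (Suc m)
  have "0 \<le> B" by (rule order_trans [OF norm_ge_zero assms(2) [OF assms(3)]])
  then have "0 \<le> (b - a) ^ m * B" using ab by simp
  have "norm ((volterra ^^ Suc m) v s) \<le> ((b - a) ^ m * B) * (s - a)"
    using Suc unfolding funpow.simps o_apply volterra_def [of "(volterra ^^ m) v"]
    by (intro integral_bound continuous_on_subset [OF volterra_iterated_continuous_on [OF assms(1)]]) auto
  also have "\<dots> \<le> ((b - a) ^ m * B) * (b - a)"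
    using Suc.prems \<open>0 \<le> (b - a) ^ m * B\<close> by (intro mult_left_mono) auto
  finally show ?case by (simp add: mult_ac)
qed (use assms(2) in simp)

lemma taylor_iterated_integral:
  fixes D :: "nat \<Rightarrow> real \<Rightarrow> 'a::banach"
  assumes "\<And>i s. i < m \<Longrightarrow> s \<in> {a..b} \<Longrightarrow> (D i has_vector_derivative D (Suc i) s) (at s within {a..b})"
    and "continuous_on {a..b} (D m)"
  shows "\<exists>q. vpoly m q \<and> (\<forall>s\<in>{a..b}. D 0 s = q s + (volterra ^^ m) (D m) s)"
  using assms
proof (induction m arbitrary: D)
  case 0
  then show ?case by (intro exI [of _ "\<lambda>_. 0"]) (simp add: vpoly_0)
next
  case (Suc m)
  have "\<exists>q. vpoly m q \<and> (\<forall>s\<in>{a..b}. D (Suc 0) s = q s + (volterra ^^ m) (D (Suc m)) s)"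
    by (rule Suc.IH [of "\<lambda>i. D (Suc i)"]) (use Suc.prems in auto)
  then obtain q where q: "vpoly m q"
    and D1: "\<And>s. s \<in> {a..b} \<Longrightarrow> D (Suc 0) s = q s + (volterra ^^ m) (D (Suc m)) s"
    by blast
  from vpoly_antiderivative [OF q]
  obtain Q where "vpoly (Suc m) Q \<and> (\<forall>s S. (Q has_vector_derivative q s) (at s within S))" ..
  then have Q: "vpoly (Suc m) Q" "\<And>s S. (Q has_vector_derivative q s) (at s within S)" by auto
  have "D 0 s = (Q s + (D 0 a - Q a)) + (volterra ^^ Suc m) (D (Suc m)) s" if s: "s \<in> {a..b}" for s
  proof -
    have sub: "{a..s} \<subseteq> {a..b}" using s by auto
    have "(D (Suc 0) has_integral (D 0 s - D 0 a)) {a..s}"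
      using s sub by (intro fundamental_theorem_of_calculus
          has_vector_derivative_within_subset [OF Suc.prems(1) sub]) auto
    then have "D 0 s - D 0 a = integral {a..s} (D (Suc 0))" by (simp add: integral_unique)
    also have "\<dots> = integral {a..s} (\<lambda>s. q s + (volterra ^^ m) (D (Suc m)) s)"
      using sub by (intro integral_cong D1) auto
    also have "\<dots> = integral {a..s} q + integral {a..s} ((volterra ^^ m) (D (Suc m)))"
      by (intro integral_add integrable_continuous_real vpoly_continuous_on [OF q]
          continuous_on_subset [OF volterra_iterated_continuous_on [OF Suc.prems(2)] sub])
    also have "integral {a..s} q = Q s - Q a"
      using s by (intro integral_unique fundamental_theorem_of_calculus Q(2)) auto
    finally show ?thesis by (simp add: volterra_def [of "(volterra ^^ m) _"] algebra_simps)
  qed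
  moreover have "vpoly (Suc m) (\<lambda>s. Q s + (D 0 a - Q a))"
    by (intro vpoly_add Q(1) vpoly_const)
  ultimately show ?case by blast
qed

lemma radau_vpoly:
  assumes "vpoly r v" "r \<ge> 1"
  shows "radau r v s = v s"
proof -
  obtain d where "\<And>s. v s = (\<Sum>j<r. poly (lpol j) s *\<^sub>R d j)"
    using vpoly_lpol_expansion [OF assms(1)] by blast
  then have "v = (\<lambda>s. \<Sum>j<r. poly (lpol j) s *\<^sub>R d j)" by blast
  then have "lcoef r v = 0" by (simp add: lcoef_expansion)
  moreover have "radau_defect r v s = 0"
    using assms by (intro radau_defect_vpoly) (auto intro: vpoly_mono)
  ultimately show ?thesis by (simp add: radau_defect_def)
qed

text \<open>
The defect does not see the Taylor polynomial of degree \<open>r\<close>, so it is the defect of the remainder,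
each integration in which contributes a factor \<open>b - a\<close>.
\<close>

lemma radau_defect_smooth:
  fixes D :: "nat \<Rightarrow> real \<Rightarrow> 'a::banach"
  assumes "\<And>i s. i < r + 1 \<Longrightarrow> s \<in> {a..b} \<Longrightarrow> (D i has_vector_derivative D (Suc i) s) (at s within {a..b})"
    and "continuous_on {a..b} (D (r + 1))" and "r \<ge> 1"
    and B: "\<And>s. s \<in> {a..b} \<Longrightarrow> norm (D (r + 1) s) \<le> B" and s: "s \<in> {a..b}"
  shows "norm (radau_defect r (D 0) s) \<le> radau_defect_bound r * ((b - a) ^ (r + 1) * B)"
proof -
  let ?w = "(volterra ^^ (r + 1)) (D (r + 1))"
  obtain q where q: "vpoly (r + 1) q" "\<And>s. s \<in> {a..b} \<Longrightarrow> D 0 s = q s + ?w s"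
    using taylor_iterated_integral [of "r + 1" D] assms by blast
  have w: "continuous_on {a..b} ?w" by (intro volterra_iterated_continuous_on assms)
  have "radau_defect r (D 0) s = radau_defect r (\<lambda>s. q s + ?w s) s"
    by (intro radau_defect_cong q s)
  also have "\<dots> = radau_defect r ?w s"
    by (subst radau_defect_add [OF vpoly_continuous_on [OF q(1)] w])
       (simp add: radau_defect_vpoly [OF q(1) assms(3)])
  finally show ?thesis
    using norm_radau_defect_le [OF w s norm_volterra_iterated_le [OF assms(2) B], of r] by simp
qed

text \<open>
The remainder of order \<open>r\<close> lies in \<open>\<H>\<close> because the derivative of order \<open>r\<close> does, continuously. Hence
the Taylor polynomial, too, has values in \<open>\<H>\<close> where the function has, and these determine its
coefficients. In particular the function belongs to \<open>\<H>\<close> at \<open>a\<close> as well.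
\<close>

lemma smooth_lift:
  fixes \<iota> :: "'h::banach \<Rightarrow>\<^sub>L 'l::banach" and D :: "nat \<Rightarrow> real \<Rightarrow> 'l"
  assumes "\<And>i s. i < r \<Longrightarrow> s \<in> {a..b} \<Longrightarrow> (D i has_vector_derivative D (Suc i) s) (at s within {a..b})"
    and "continuous_on {a..b} (D r)"
    and range: "\<And>s. s \<in> {a<..b} \<Longrightarrow> D 0 s \<in> range (blinfun_apply \<iota>)"
    and h: "continuous_on {a..b} h" "\<And>s. s \<in> {a..b} \<Longrightarrow> \<iota> (h s) = D r s"
  shows "\<exists>Q. vpoly r Q \<and> (\<forall>s\<in>{a..b}. D 0 s = \<iota> (Q s + (volterra ^^ r) h s))"
proof -
  obtain q where q: "vpoly r q" "\<And>s. s \<in> {a..b} \<Longrightarrow> D 0 s = q s + (volterra ^^ r) (D r) s"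
    using taylor_iterated_integral [of r D] assms by blast
  have w: "(volterra ^^ r) (D r) s = \<iota> ((volterra ^^ r) h s)" if "s \<in> {a..b}" for s
    using volterra_iterated_cong [of "D r" "\<lambda>s. \<iota> (h s)"] h that
    by (simp add: volterra_iterated_linear blinfun.bounded_linear_right)
  have "q s \<in> range (blinfun_apply \<iota>)" if s: "s \<in> {a<..b}" for s
  proof -
    have "q s = D 0 s - \<iota> ((volterra ^^ r) h s)" using q(2) [of s] w [of s] s by simp
    with range [OF s] show ?thesis by (auto simp flip: blinfun.diff_right)
  qed
  from vpoly_lift_range [OF q(1) ab this]
  obtain Q where "vpoly r Q" "\<And>s. \<iota> (Q s) = q s" by blast
  then show ?thesis using q w by (intro exI [of _ Q]) (auto simp: blinfun.add_right)
qed

end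


section \<open>The error in a single step\<close>

lemma bounded_linear_L_to_dual: "bounded_linear (L_to_dual \<iota>)"
  unfolding L_to_dual_def [abs_def]
  by (rule bounded_linear_compose [OF bounded_bilinear.bounded_linear_left
        [OF bounded_bilinear_blinfun_compose] bounded_linear_blinfun_inner_right])

text \<open>
By ellipticity, \<open>c \<parallel>x\<parallel>\<^sup>2 \<le> \<langle>A x, x\<rangle> \<le> \<parallel>A x\<parallel> \<parallel>\<iota> x\<parallel>\<close> if \<open>A x\<close> is in \<open>\<L>\<close>; applied to differences, this
makes \<open>h\<close> Lipschitz continuous as a function of \<open>y\<close>.
\<close>

lemma elliptic_preimage_continuous_on:
  fixes \<iota> :: "'h::{real_inner,banach} \<Rightarrow>\<^sub>L 'l::{real_inner,banach}"
    and A :: "'h \<Rightarrow>\<^sub>L ('h \<Rightarrow>\<^sub>L real)"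
  assumes "strictly_positive_definite_op A" "continuous_on S y"
    and Ah: "\<And>s. s \<in> S \<Longrightarrow> A (h s) = L_to_dual \<iota> (y s)"
  shows "continuous_on S h"
proof -
  obtain c where c: "c > 0" "\<And>v. c * (norm v)\<^sup>2 \<le> A v v"
    using assms(1) by (auto simp: strictly_positive_definite_op_def)
  have lipschitz: "c * norm (h s - h s') \<le> norm (y s - y s') * norm \<iota>" if "s \<in> S" "s' \<in> S" for s s'
  proof (cases "h s = h s'")
    case False
    let ?d = "h s - h s'"
    have "c * (norm ?d)\<^sup>2 \<le> A ?d ?d" by (rule c)
    also have "\<dots> = (y s - y s') \<bullet> \<iota> ?d"
      using that by (simp add: blinfun.diff_right blinfun.diff_left Ah inner_diff_left inner_diff_right)
    also have "\<dots> \<le> norm (y s - y s') * norm (\<iota> ?d)" by (rule norm_cauchy_schwarz)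
    also have "\<dots> \<le> norm (y s - y s') * (norm \<iota> * norm ?d)"
      by (intro mult_left_mono norm_blinfun) simp
    finally have "(c * norm ?d) * norm ?d \<le> (norm (y s - y s') * norm \<iota>) * norm ?d"
      by (simp add: power2_eq_square mult_ac)
    then show ?thesis using False by simp
  qed (use c in simp)
  have "(h \<longlongrightarrow> h s) (at s within S)" if s: "s \<in> S" for s
  proof -
    have "((\<lambda>s'. norm (y s' - y s) * norm \<iota> / c) \<longlongrightarrow> norm (y s - y s) * norm \<iota> / c) (at s within S)"
      using assms(2) s c(1) by (intro tendsto_intros) (auto simp: continuous_on_def)
    then have lim: "((\<lambda>s'. norm (y s' - y s) * norm \<iota> / c) \<longlongrightarrow> 0) (at s within S)" by simp
    have "\<forall>\<^sub>F s' in at s within S. norm (h s' - h s) \<le> norm (y s' - y s) * norm \<iota> / c"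
      unfolding eventually_at_filter
      using lipschitz [OF _ s] c(1) by (intro always_eventually) (auto simp: pos_le_divide_eq mult.commute)
    from Lim_null_comparison [OF this lim] show ?thesis by (rule LIM_zero_cancel)
  qed
  then show ?thesis by (auto simp: continuous_on_def)
qed

context time_step
begin

text \<open>
Here \<open>P\<close> is the discrete solution, \<open>\<iota> w\<close> the exact one and \<open>R\<close> the Radau projection of \<open>w\<close>. Integrate by parts in the term
with the time derivative, for the solution and for the projection: the values at \<open>b\<close> agree, and the
derivative of a test function has one coefficient less, so that it does not distinguish \<open>R\<close> from \<open>w\<close>.
The two derivatives, tested with \<open>X\<close>, thus differ only by a term at \<open>a\<close>, and this turns the jump of \<open>P\<close>
there into the jump of \<open>P - R\<close>, with the initial error in place of \<open>d\<close>.
\<close>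

lemma radau_error_equation:
  fixes \<iota> :: "'h::{real_inner,banach} \<Rightarrow>\<^sub>L 'l::{real_inner,banach}"
    and A :: "'h \<Rightarrow>\<^sub>L ('h \<Rightarrow>\<^sub>L real)"
  assumes P: "vpoly r P" "vpoly r P'"
    and w: "continuous_on {a..b} w" 
    and u': "continuous_on {a..b} u'"
      "\<And>s. s \<in> {a..b} \<Longrightarrow> ((\<lambda>s. \<iota> (w s)) has_vector_derivative u' s) (at s within {a..b})"
    and R: "R = radau r w" "vpoly r R'"
      "\<And>s. s \<in> {a..b} \<Longrightarrow> (R has_vector_derivative R' s) (at s within {a..b})"
    and r: "r \<ge> 1"
    and g: "\<And>s. s \<in> {a..b} \<Longrightarrow> A (w s - R s) = L_to_dual \<iota> (g s)"
    and X: "vpoly r X"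
    and eq: "\<iota> (P a) \<bullet> \<iota> (X a) + integral {a..b} (\<lambda>s. \<iota> (P' s) \<bullet> \<iota> (X s) + A (P s) (X s))
        = d \<bullet> \<iota> (X a) + integral {a..b} (\<lambda>s. u' s \<bullet> \<iota> (X s) + A (w s) (X s))"
  shows "\<iota> (P a - R a) \<bullet> \<iota> (X a)
        + integral {a..b} (\<lambda>s. \<iota> (P' s - R' s) \<bullet> \<iota> (X s) + A (P s - R s) (X s))
        = (d - \<iota> (w a)) \<bullet> \<iota> (X a) + integral {a..b} (\<lambda>s. g s \<bullet> \<iota> (X s))"
proof -
  have Rp: "vpoly r R" unfolding R(1) by (rule vpoly_radau [OF r])
  from vpoly_has_derivative [OF X]
  obtain X' where "vpoly (r - 1) X' \<and> (\<forall>s S. (X has_vector_derivative X' s) (at s within S))" ..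
  then have X': "vpoly (r - 1) X'" "\<And>s S. (X has_vector_derivative X' s) (at s within S)" by auto
  have \<iota>_cont [continuous_intros]: "continuous_on {a..b} (\<lambda>s. \<iota> (Y s))" if "continuous_on {a..b} Y" for Y
    using that by (rule bounded_linear.continuous_on [OF blinfun.bounded_linear_right])
  have form_cont [continuous_intros]: "continuous_on {a..b} (\<lambda>s. A (Y s) (Z s))"
    if "continuous_on {a..b} Y" "continuous_on {a..b} Z" for Y Z
    using that by (intro bounded_bilinear.continuous_on [OF bounded_bilinear_form])
  note cont [continuous_intros] = w u'(1) vpoly_continuous_on [OF P(1)] vpoly_continuous_on [OF P(2)]
    vpoly_continuous_on [OF Rp] vpoly_continuous_on [OF R(2)] vpoly_continuous_on [OF X]
    vpoly_continuous_on [OF X'(1)]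
  have \<iota>_deriv: "((\<lambda>s. \<iota> (Y s)) has_vector_derivative \<iota> Y') (at s within {a..b})"
    if "(Y has_vector_derivative Y') (at s within {a..b})" for Y Y' s
    using that by (rule bounded_linear.has_vector_derivative [OF blinfun.bounded_linear_right])
  define I where "I Y Z = integral {a..b} (\<lambda>s. Y s \<bullet> \<iota> (Z s))" for Y :: "real \<Rightarrow> 'l" and Z :: "real \<Rightarrow> 'h"
  define F where "F Y = integral {a..b} (\<lambda>s. A (Y s) (X s))" for Y :: "real \<Rightarrow> 'h"

  have parts_u: "I u' X + I (\<lambda>s. \<iota> (w s)) X' = \<iota> (w b) \<bullet> \<iota> (X b) - \<iota> (w a) \<bullet> \<iota> (X a)"
  proof -
    have "((\<lambda>s. u' s \<bullet> \<iota> (X s) + \<iota> (w s) \<bullet> \<iota> (X' s)) has_integral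
        (\<iota> (w b) \<bullet> \<iota> (X b) - \<iota> (w a) \<bullet> \<iota> (X a))) {a..b}"
      by (rule integral_inner_derivative [OF u'(2) \<iota>_deriv [OF X'(2)]])
    from integral_unique [OF this] show ?thesis
      unfolding I_def by (subst integral_add [symmetric])
        (intro integrable_continuous_real continuous_intros | simp)+
  qed
  have parts_R: "I (\<lambda>s. \<iota> (R' s)) X + I (\<lambda>s. \<iota> (R s)) X' = \<iota> (R b) \<bullet> \<iota> (X b) - \<iota> (R a) \<bullet> \<iota> (X a)"
  proof -
    have "((\<lambda>s. \<iota> (R' s) \<bullet> \<iota> (X s) + \<iota> (R s) \<bullet> \<iota> (X' s)) has_integral
        (\<iota> (R b) \<bullet> \<iota> (X b) - \<iota> (R a) \<bullet> \<iota> (X a))) {a..b}"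
      by (rule integral_inner_derivative [OF \<iota>_deriv [OF R(3)] \<iota>_deriv [OF X'(2)]])
    from integral_unique [OF this] show ?thesis
      unfolding I_def by (subst integral_add [symmetric])
        (intro integrable_continuous_real continuous_intros | simp)+
  qed
  have "integral {a..b} (\<lambda>s. \<iota> (X' s) \<bullet> \<iota> (R s)) = integral {a..b} (\<lambda>s. \<iota> (X' s) \<bullet> \<iota> (w s))"
    by (rule integral_bilinear_eq_if_lcoef_eq [OF bounded_bilinear_inner_image X'(1)])
       (auto intro!: continuous_intros simp: R(1) lcoef_radau vpoly_continuous_on [OF vpoly_radau [OF r]])
  then have ortho: "I (\<lambda>s. \<iota> (R s)) X' = I (\<lambda>s. \<iota> (w s)) X'"
    by (simp add: I_def inner_commute)
  have "R b = w b" by (simp add: R(1) radau_right)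
  with parts_u parts_R ortho
  have consistency: "I u' X + \<iota> (w a) \<bullet> \<iota> (X a) = I (\<lambda>s. \<iota> (R' s)) X + \<iota> (R a) \<bullet> \<iota> (X a)"
    by simp
  have split: "integral {a..b} (\<lambda>s. Y s \<bullet> \<iota> (X s) + A (Z s) (X s)) = I Y X + F Z"
    if "continuous_on {a..b} Y" "continuous_on {a..b} Z" for Y Z
    unfolding I_def F_def using that by (intro integral_add integrable_continuous_real continuous_intros)
  have I_diff: "I (\<lambda>s. Y s - Z s) X = I Y X - I Z X" if "continuous_on {a..b} Y" "continuous_on {a..b} Z" for Y Z
    unfolding I_def inner_diff_left using that
    by (intro integral_diff integrable_continuous_real continuous_intros)
  have F_diff: "F (\<lambda>s. Y s - Z s) = F Y - F Z" if "continuous_on {a..b} Y" "continuous_on {a..b} Z" for Y Z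
    unfolding F_def blinfun.diff_left blinfun.diff_right using that
    by (intro integral_diff integrable_continuous_real continuous_intros)
  have "I g X = F (\<lambda>s. w s - R s)"
    unfolding I_def F_def by (intro integral_cong) (simp add: g)
  also have "\<dots> = F w - F R" by (intro F_diff continuous_intros)
  finally have Ig: "I g X = F w - F R" .
  have eq': "\<iota> (P a) \<bullet> \<iota> (X a) + (I (\<lambda>s. \<iota> (P' s)) X + F P) = d \<bullet> \<iota> (X a) + (I u' X + F w)"
    using eq by (subst (asm) (1 2) split) (auto intro!: continuous_intros)
  have "integral {a..b} (\<lambda>s. \<iota> (P' s - R' s) \<bullet> \<iota> (X s) + A (P s - R s) (X s))
      = I (\<lambda>s. \<iota> (P' s - R' s)) X + F (\<lambda>s. P s - R s)"
    by (intro split continuous_intros)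
  also have "\<dots> = (I (\<lambda>s. \<iota> (P' s)) X - I (\<lambda>s. \<iota> (R' s)) X) + (F P - F R)"
    unfolding blinfun.diff_right by (intro arg_cong2 [of _ _ _ _ "(+)"] I_diff F_diff continuous_intros)
  finally show ?thesis
    using Ig eq' consistency
    by (simp add: I_def [of g] blinfun.diff_right inner_diff_left)
qed

text \<open>
The estimate for one step in terms of a polynomial \<open>P\<close> on the closed interval. The equation is assumed
for each \<open>\<H>\<close>-valued representative \<open>w\<close> of the solution, as the existence of one on the closed interval
is part of the proof.
\<close>

lemma dG_step_error:
  fixes \<iota> :: "'h::{real_inner,banach} \<Rightarrow>\<^sub>L 'l::{real_inner,banach}"
    and A :: "'h \<Rightarrow>\<^sub>L ('h \<Rightarrow>\<^sub>L real)"
  assumes A: "strictly_positive_definite_op A"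
    and D: "\<And>i s. i < r + 1 \<Longrightarrow> s \<in> {a..b} \<Longrightarrow> (D i has_vector_derivative D (Suc i) s) (at s within {a..b})"
      "continuous_on {a..b} (D (r + 1))"
    and range: "\<And>s. s \<in> {a<..b} \<Longrightarrow> D 0 s \<in> range (blinfun_apply \<iota>)"
    and h: "\<And>s. s \<in> {a..b} \<Longrightarrow> \<iota> (h s) = D r s" "\<And>s. s \<in> {a..b} \<Longrightarrow> A (h s) = L_to_dual \<iota> (y s)"
    and y: "continuous_on {a..b} y" "\<And>s. s \<in> {a..b} \<Longrightarrow> norm (y s) \<le> Y"
    and B: "\<And>s. s \<in> {a..b} \<Longrightarrow> norm (D (r + 1) s) \<le> B"
    and r: "r \<ge> 1"
    and P: "vpoly r P" "vpoly r P'" "\<And>s. s \<in> {a..b} \<Longrightarrow> (P has_vector_derivative P' s) (at s within {a..b})"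
    and eq: "\<And>w X. (\<And>s. s \<in> {a..b} \<Longrightarrow> \<iota> (w s) = D 0 s) \<Longrightarrow> vpoly r X \<Longrightarrow>
        \<iota> (P a) \<bullet> \<iota> (X a) + integral {a..b} (\<lambda>s. \<iota> (P' s) \<bullet> \<iota> (X s) + A (P s) (X s))
        = d \<bullet> \<iota> (X a) + integral {a..b} (\<lambda>s. D 1 s \<bullet> \<iota> (X s) + A (w s) (X s))"
    and s: "s \<in> {a..b}"
  shows "norm (\<iota> (P s) - D 0 s + (poly (lpol r) s - poly (lpol (r - 1)) s) *\<^sub>R lcoef r (D 0))
      \<le> stability_const r * (norm (d - D 0 a) + (1 + radau_bound r) * ((b - a) ^ (r + 1) * Y))
        + radau_defect_bound r * ((b - a) ^ (r + 1) * B)"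
proof -
  have h_cont: "continuous_on {a..b} h"
    by (rule elliptic_preimage_continuous_on [OF A y(1) h(2)])
  have D_cont: "continuous_on {a..b} (D i)" if "i < r + 1" for i
    using D(1) [OF that] by (rule continuous_on_vector_derivative)
  obtain Q where Q: "vpoly r Q" and u: "\<And>s. s \<in> {a..b} \<Longrightarrow> D 0 s = \<iota> (Q s + (volterra ^^ r) h s)"
    using smooth_lift [of r D \<iota> h] D D_cont range h_cont h(1) by (metis less_add_one less_SucI add.commute plus_1_eq_Suc)
  define W where "W = (volterra ^^ r) h"
  define w where "w s = Q s + W s" for s
  \<comment> \<open>\<open>A W\<close> as an \<open>\<L>\<close>-valued function\<close>
  define z where "z = (volterra ^^ r) y"
  define g where "g s = z s - radau r z s" for s
  have W_cont: "continuous_on {a..b} W" unfolding W_def by (rule volterra_iterated_continuous_on [OF h_cont])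
  have z_cont: "continuous_on {a..b} z" unfolding z_def by (rule volterra_iterated_continuous_on [OF y(1)])
  have w_cont: "continuous_on {a..b} w"
    unfolding w_def by (intro continuous_intros vpoly_continuous_on [OF Q] W_cont)
  have g_cont: "continuous_on {a..b} g"
    unfolding g_def by (intro continuous_intros z_cont vpoly_continuous_on [OF vpoly_radau [OF r]])
  have \<iota>w: "\<iota> (w s) = D 0 s" if "s \<in> {a..b}" for s using u [OF that] by (simp add: w_def W_def)
  have AW: "A (W s) = L_to_dual \<iota> (z s)" if "s \<in> {a..b}" for s
  proof -
    have "A (W s) = (volterra ^^ r) (\<lambda>s. A (h s)) s"
      unfolding W_def by (rule volterra_iterated_linear [OF h_cont blinfun.bounded_linear_right that, symmetric])
    also have "\<dots> = (volterra ^^ r) (\<lambda>s. L_to_dual \<iota> (y s)) s"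
      by (rule volterra_iterated_cong [OF h(2) that])
    also have "\<dots> = L_to_dual \<iota> (z s)"
      unfolding z_def by (rule volterra_iterated_linear [OF y(1) bounded_linear_L_to_dual that])
    finally show ?thesis .
  qed
  have A_radau: "A (w s - radau r w s) = L_to_dual \<iota> (g s)" if "s \<in> {a..b}" for s
  proof -
    \<comment> \<open>the polynomial part of \<open>w\<close> is fixed by the projection, so its image under \<open>A\<close>, which need
        not be in \<open>\<L>\<close>, cancels\<close>
    have "radau r w s = Q s + radau r W s"
      unfolding w_def [abs_def]
      by (simp add: radau_add [OF vpoly_continuous_on [OF Q] W_cont] radau_vpoly [OF Q r])
    then have "A (w s - radau r w s) = A (W s) - A (radau r W s)"
      by (simp add: w_def blinfun.diff_right)
    also have "A (radau r W s) = radau r (\<lambda>s. A (W s)) s"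
      by (rule radau_linear [OF W_cont blinfun.bounded_linear_right, symmetric])
    also have "\<dots> = radau r (\<lambda>s. L_to_dual \<iota> (z s)) s"
      by (rule radau_cong [OF AW])
    also have "\<dots> = L_to_dual \<iota> (radau r z s)"
      by (rule radau_linear [OF z_cont bounded_linear_L_to_dual])
    finally show ?thesis
      using AW [OF that] linear_diff [OF bounded_linear.linear [OF bounded_linear_L_to_dual], of \<iota>] by (simp add: g_def)
  qed
  define R where "R = radau r w"
  have Rp: "vpoly r R" unfolding R_def by (rule vpoly_radau [OF r])
  from vpoly_has_derivative [OF Rp]
  obtain R' where "vpoly (r - 1) R' \<and> (\<forall>s S. (R has_vector_derivative R' s) (at s within S))" ..
  then have R': "vpoly r R'" "\<And>s S. (R has_vector_derivative R' s) (at s within S)"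
    by (auto intro: vpoly_mono)
  have g_le: "norm (g s) \<le> (1 + radau_bound r) * ((b - a) ^ r * Y)" if s: "s \<in> {a..b}" for s
  proof -
    have z_le: "norm (z s) \<le> (b - a) ^ r * Y" if "s \<in> {a..b}" for s
      unfolding z_def by (rule norm_volterra_iterated_le [OF y that])
    show ?thesis
      using norm_triangle_ineq4 [of "z s" "radau r z s"] z_le [OF s] norm_radau_le [OF z_cont s z_le, of r]
      by (simp add: g_def algebra_simps)
  qed
  have u': "((\<lambda>s. \<iota> (w s)) has_vector_derivative D 1 s) (at s within {a..b})" if "s \<in> {a..b}" for s
    using D(1) [of 0 s] that \<iota>w by (auto intro: has_vector_derivative_transform)
  have error_eq: "\<iota> (P a - R a) \<bullet> \<iota> (X a)
        + integral {a..b} (\<lambda>s. \<iota> (P' s - R' s) \<bullet> \<iota> (X s) + A (P s - R s) (X s))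
        = (d - D 0 a) \<bullet> \<iota> (X a) + integral {a..b} (\<lambda>s. g s \<bullet> \<iota> (X s))" if X: "vpoly r X" for X
  proof -
    have "continuous_on {a..b} (D 1)"
      by (cases "r + 1 = 1") (use r D_cont [of 1] in auto)
    from radau_error_equation [OF P(1,2) w_cont this u' R_def R'(1,2) r _ X eq [OF \<iota>w X], of g]
    show ?thesis using A_radau \<iota>w [of a] ab by (simp add: R_def)
  qed
  have "norm (\<iota> (P s - R s))
      \<le> stability_const r * (norm (d - D 0 a) + (b - a) * ((1 + radau_bound r) * ((b - a) ^ r * Y)))"
  proof (rule dG_step_stability [OF _ _ _ _ g_cont g_le error_eq s])
    show "0 \<le> A x x" for x
    proof -
      obtain c where "c > 0" "c * (norm x)\<^sup>2 \<le> A x x"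
        using A by (auto simp: strictly_positive_definite_op_def)
      moreover from \<open>c > 0\<close> have "0 \<le> c * (norm x)\<^sup>2" by simp
      ultimately show ?thesis by linarith
    qed
    show "((\<lambda>s. P s - R s) has_vector_derivative P' s - R' s) (at s within {a..b})" if "s \<in> {a..b}" for s
      using P(3) [OF that] R'(2) by (rule has_vector_derivative_diff)
  qed (intro vpoly_diff P Rp R')+
  moreover have "\<iota> (R s) - D 0 s + (poly (lpol r) s - poly (lpol (r - 1)) s) *\<^sub>R lcoef r (D 0)
      = radau_defect r (D 0) s"
  proof -
    have "\<iota> (R s) = radau r (\<lambda>s. \<iota> (w s)) s"
      unfolding R_def by (rule radau_linear [OF w_cont blinfun.bounded_linear_right, symmetric])
    also have "\<dots> = radau r (D 0) s" by (rule radau_cong [OF \<iota>w])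
    finally show ?thesis by (simp add: radau_defect_def)
  qed
  moreover have "norm (radau_defect r (D 0) s) \<le> radau_defect_bound r * ((b - a) ^ (r + 1) * B)"
    by (rule radau_defect_smooth [OF D r B s])
  moreover have "\<iota> (P s) - D 0 s + (poly (lpol r) s - poly (lpol (r - 1)) s) *\<^sub>R lcoef r (D 0)
      = \<iota> (P s - R s) + (\<iota> (R s) - D 0 s + (poly (lpol r) s - poly (lpol (r - 1)) s) *\<^sub>R lcoef r (D 0))"
    by (simp add: blinfun.diff_right)
  ultimately show ?thesis
    using norm_triangle_ineq [of "\<iota> (P s - R s)" "radau_defect r (D 0) s"]
    by (simp add: mult_ac)
qed

end


section \<open>The error of the discontinuous Galerkin solution\<close>

text \<open>
For continuous functions, the supremum over the open interval also bounds the values at the end points.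
\<close>

lemma interval_norm_upper:
  assumes "t (n - 1) < t n" "continuous_on {t (n - 1)..t n} v" "s \<in> {t (n - 1)..t n}"
  shows "norm (v s) \<le> interval_norm t n v"
proof -
  have cl: "closure (time_interval t n) = {t (n - 1)..t n}"
    using assms(1) by (rule closure_greaterThanLessThan)
  have "bdd_above ((\<lambda>s. norm (v s)) ` {t (n - 1)..t n})"
    by (intro bounded_imp_bdd_above compact_imp_bounded compact_continuous_image
        continuous_intros assms(2) compact_Icc)
  then have "bdd_above ((\<lambda>s. norm (v s)) ` time_interval t n)"
    by (rule bdd_above_mono) auto
  then have "norm (v x) \<le> interval_norm t n v" if "x \<in> time_interval t n" for x
    unfolding interval_norm_def using that by (intro cSUP_upper)
  then show ?thesis
    using continuous_on_closure_norm_le [of "time_interval t n" v, unfolded cl, OF assms(2) _ assms(3)]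
    by blast
qed

lemma interval_norm_least:
  assumes "t (n - 1) < t n" "\<And>s. s \<in> time_interval t n \<Longrightarrow> norm (v s) \<le> B"
  shows "interval_norm t n v \<le> B"
  unfolding interval_norm_def using assms by (intro cSUP_least) auto

lemma interval_norm_nonneg:
  assumes "t (n - 1) < t n" "continuous_on {t (n - 1)..t n} v"
  shows "0 \<le> interval_norm t n v"
  using interval_norm_upper [OF assms, of "t n"] assms(1) by (intro order_trans [OF norm_ge_zero]) auto

lemma time_levels_mono:
  assumes "time_levels T N t" "i \<le> j" "j \<le> N"
  shows "t i \<le> t j"
  using assms(2,3)
proof (induction j rule: dec_induct)
  case (step j)
  have "Suc j \<in> {1..N}" using step.prems by simp
  with assms(1) have "t (Suc j - 1) < t (Suc j)" unfolding time_levels_def by blast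
  with step show ?case by simp
qed simp

lemma C_times_on_has_vector_derivative:
  assumes "C_times_on m S v" "i < m" "s \<in> S"
  shows "(nth_vector_deriv i S v has_vector_derivative nth_vector_deriv (Suc i) S v s) (at s within S)"
  using assms by (simp add: C_times_on_def vector_derivative_works)

lemma limit_right_eq:
  fixes X :: "real \<Rightarrow> 'a::real_normed_vector"
  assumes "t n < b" "\<And>s. s \<in> {t n<..<b} \<Longrightarrow> X s = P s" "isCont P (t n)"
  shows "limit_right t X n = P (t n)"
  unfolding limit_right_def
proof (rule tendsto_Lim)
  have "(P \<longlongrightarrow> P (t n)) (at_right (t n))"
    using assms(3) by (simp add: isCont_def filterlim_at_split)
  moreover have "\<forall>\<^sub>F s in at_right (t n). P s = X s"
    unfolding eventually_at_right_field using assms(1,2) by (intro exI [of _ b]) auto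
  ultimately show "(X \<longlongrightarrow> P (t n)) (at_right (t n))"
    by (rule Lim_transform_eventually)
qed simp

text \<open>
At interior points the weak derivative, taken in the dual of \<open>\<H>\<close>, and the classical derivative in \<open>\<L>\<close>
coincide. So the right-hand side of the equation can be expressed by the solution.
\<close>

lemma solution_rhs:
  assumes "inj (blinfun_apply \<iota>)" and sol: "is_solution \<iota> A T f u0 u"
    and "0 \<le> a" "b \<le> T" "s \<in> {a<..<b}"
    and u': "(u has_vector_derivative u') (at s within {a..b})"
    and w: "\<iota> w = u s"
  shows "f s = L_to_dual \<iota> u' + A w"
proof -
  have "s \<in> {0<..T}" and "at s within {0..T} = at s" and "at s within {a..b} = at s"
    using assms(3-5) by (auto intro!: at_within_interior)
  have "((\<lambda>s. L_to_dual \<iota> (u s)) has_vector_derivative (f s - op_on_L \<iota> A (u s))) (at s within {0..T})"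
    using sol \<open>s \<in> {0<..T}\<close> unfolding is_solution_def by blast
  then have 1: "((\<lambda>s. L_to_dual \<iota> (u s)) has_vector_derivative (f s - op_on_L \<iota> A (u s))) (at s)"
    by (simp only: \<open>at s within {0..T} = at s\<close>)
  have 2: "((\<lambda>s. L_to_dual \<iota> (u s)) has_vector_derivative L_to_dual \<iota> u') (at s)"
    using bounded_linear.has_vector_derivative [OF bounded_linear_L_to_dual u', of \<iota>]
    by (simp add: \<open>at s within {a..b} = at s\<close>)
  have "op_on_L \<iota> A (u s) = A w"
    unfolding op_on_L_def w [symmetric] using assms(1) by simp
  with vector_derivative_unique_at [OF 1 2] show ?thesis by (simp add: algebra_simps)
qed

lemma dG_local_error:
  fixes \<iota> :: "'h::{real_inner,banach} \<Rightarrow>\<^sub>L 'l::{real_inner,banach}"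
    and A :: "'h \<Rightarrow>\<^sub>L ('h \<Rightarrow>\<^sub>L real)"
  assumes inj: "inj (blinfun_apply \<iota>)" and A: "strictly_positive_definite_op A" and r: "r \<ge> 1"
    and levels: "time_levels T N t" and sol: "is_solution \<iota> A T f u0 u"
    and dG: "is_dG_solution \<iota> A r N t f u0 U" and n: "n \<in> {1..N}"
    and I: "I = {t (n - 1)..t n}"
    and smooth: "C_times_on (r + 1) I u"
    and dom: "\<And>s. s \<in> I \<Longrightarrow> nth_vector_deriv r I u s \<in> L_domain \<iota> A"
    and cont: "continuous_on I (\<lambda>s. L_valued_op \<iota> A (nth_vector_deriv r I u s))"
  shows "interval_norm t n
      (\<lambda>s. \<iota> (U s) - u s + (local_legendre t n r s - local_legendre t n (r - 1) s) *\<^sub>R legendre_coeff t n r u)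
    \<le> stability_const r * (norm (dG_left \<iota> t u0 U (n - 1) - u (t (n - 1)))
        + (1 + radau_bound r) * ((t n - t (n - 1)) ^ (r + 1)
          * interval_norm t n (\<lambda>s. L_valued_op \<iota> A (nth_vector_deriv r I u s))))
      + radau_defect_bound r * ((t n - t (n - 1)) ^ (r + 1) * interval_norm t n (nth_vector_deriv (r + 1) I u))"
proof -
  define a where "a = t (n - 1)"
  define b where "b = t n"
  have ab: "a < b" using levels n by (auto simp: time_levels_def a_def b_def)
  then interpret time_step a b by unfold_locales
  have I': "I = {a..b}" by (simp add: I a_def b_def)
  have "0 \<le> a" "b \<le> T"
    using time_levels_mono [OF levels, of 0 "n - 1"] time_levels_mono [OF levels, of n N] levels n
    by (auto simp: time_levels_def a_def b_def)
  define D where "D i = nth_vector_deriv i I u" for i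
  have D0: "D 0 = u" by (simp add: D_def)
  have D: "(D i has_vector_derivative D (Suc i) s) (at s within {a..b})" if "i < r + 1" "s \<in> {a..b}" for i s
    using C_times_on_has_vector_derivative [OF smooth that(1)] that(2) unfolding D_def I' by blast
  have D_top: "continuous_on {a..b} (D (r + 1))"
    using smooth by (simp add: C_times_on_def D_def I')
  define y where "y s = L_valued_op \<iota> A (D r s)" for s
  define h where "h s = inv (blinfun_apply \<iota>) (D r s)" for s
  have y_cont: "continuous_on {a..b} y" using cont by (simp add: y_def [abs_def] D_def I')
  have h: "\<iota> (h s) = D r s" "A (h s) = L_to_dual \<iota> (y s)" if "s \<in> {a..b}" for s
  proof -
    have *: "D r s \<in> range (blinfun_apply \<iota>)" "op_on_L \<iota> A (D r s) \<in> range (L_to_dual \<iota>)"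
      using dom [of s] that by (auto simp: L_domain_def D_def I')
    show "\<iota> (h s) = D r s" unfolding h_def using *(1) by (rule f_inv_into_f)
    have "L_to_dual \<iota> (y s) = op_on_L \<iota> A (D r s)"
      unfolding y_def L_valued_op_def using *(2) by (rule f_inv_into_f)
    then show "A (h s) = L_to_dual \<iota> (y s)" by (simp add: op_on_L_def h_def)
  qed
  have range: "D 0 s \<in> range (blinfun_apply \<iota>)" if "s \<in> {a<..b}" for s
    using sol that \<open>0 \<le> a\<close> \<open>b \<le> T\<close> by (auto simp: D0 is_solution_def)
  obtain c where c: "\<And>s. s \<in> {a<..<b} \<Longrightarrow> U s = (\<Sum>j<r. s ^ j *\<^sub>R c j)"
    using dG n unfolding is_dG_solution_def dG_space_def a_def b_def by blast
  \<comment> \<open>the polynomial that extends \<open>U\<close> from the open step to the real line\<close>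
  define P where "P s = (\<Sum>j<r. s ^ j *\<^sub>R c j)" for s
  have P: "vpoly r P" by (rule vpolyI) (simp add: P_def)
  have UP: "U s = P s" if "s \<in> {a<..<b}" for s using c [OF that] by (simp add: P_def)
  from vpoly_has_derivative [OF P]
  obtain P' where "vpoly (r - 1) P' \<and> (\<forall>s S. (P has_vector_derivative P' s) (at s within S))" ..
  then have P': "vpoly r P'" "\<And>s S. (P has_vector_derivative P' s) (at s within S)"
    by (auto intro: vpoly_mono)
  have isCont_vpoly: "isCont X s" if "vpoly r X" for X :: "real \<Rightarrow> 'h" and s
    using vpoly_continuous_on [OF that, of UNIV] by (simp add: continuous_on_eq_continuous_at)
  have limit_U: "limit_right t U (n - 1) = P a"
    using limit_right_eq [of t "n - 1" b U P] UP isCont_vpoly [OF P] ab by (simp add: a_def)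
  have dU: "vector_derivative U (at s) = P' s" if "s \<in> {a<..<b}" for s
    by (rule vector_derivative_at
        [OF has_vector_derivative_transform_within_open [OF P'(2) _ that]]) (use UP in auto)

  have eq: "\<iota> (P a) \<bullet> \<iota> (X a) + integral {a..b} (\<lambda>s. \<iota> (P' s) \<bullet> \<iota> (X s) + A (P s) (X s))
      = dG_left \<iota> t u0 U (n - 1) \<bullet> \<iota> (X a) + integral {a..b} (\<lambda>s. D 1 s \<bullet> \<iota> (X s) + A (w s) (X s))"
    if w: "\<And>s. s \<in> {a..b} \<Longrightarrow> \<iota> (w s) = D 0 s" and X: "vpoly r X" for w X
  proof -
    \<comment> \<open>a global polynomial is an admissible test function on all steps at once\<close>
    have "X \<in> dG_space r N t" using X by (auto simp: vpoly_def dG_space_def)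
    from bspec [OF bspec [OF conjunct2 [OF dG [unfolded is_dG_solution_def]] this] n]
    have "\<iota> (limit_right t U (n - 1)) \<bullet> \<iota> (limit_right t X (n - 1)) +
        integral {a<..<b} (\<lambda>s. (L_to_dual \<iota> (\<iota> (vector_derivative U (at s))) + A (U s)) (X s)) =
        dG_left \<iota> t u0 U (n - 1) \<bullet> \<iota> (limit_right t X (n - 1)) + integral {a<..<b} (\<lambda>s. f s (X s))"
      unfolding a_def b_def by (rule conjunct2)
    moreover have "limit_right t X (n - 1) = X a"
      using limit_right_eq [of t "n - 1" b X X] isCont_vpoly [OF X] ab by (simp add: a_def)
    ultimately have "\<iota> (P a) \<bullet> \<iota> (X a) +
        integral {a<..<b} (\<lambda>s. (L_to_dual \<iota> (\<iota> (vector_derivative U (at s))) + A (U s)) (X s)) =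
        dG_left \<iota> t u0 U (n - 1) \<bullet> \<iota> (X a) + integral {a<..<b} (\<lambda>s. f s (X s))"
      by (simp only: limit_U)
    also have "integral {a<..<b} (\<lambda>s. (L_to_dual \<iota> (\<iota> (vector_derivative U (at s))) + A (U s)) (X s))
        = integral {a<..<b} (\<lambda>s. \<iota> (P' s) \<bullet> \<iota> (X s) + A (P s) (X s))"
      by (intro integral_cong) (simp add: dU UP blinfun.add_left)
    also have "integral {a<..<b} (\<lambda>s. f s (X s)) = integral {a<..<b} (\<lambda>s. D 1 s \<bullet> \<iota> (X s) + A (w s) (X s))"
    proof (intro integral_cong)
      fix s assume s: "s \<in> {a<..<b}"
      then have "(u has_vector_derivative D 1 s) (at s within {a..b})" and "\<iota> (w s) = u s"
        using D [of 0 s] w [of s] by (auto simp: D0)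
      from solution_rhs [OF inj sol \<open>0 \<le> a\<close> \<open>b \<le> T\<close> s this]
      show "f s (X s) = D 1 s \<bullet> \<iota> (X s) + A (w s) (X s)" by (simp add: blinfun.add_left)
    qed
    finally show ?thesis by (simp add: integral_open_interval_real)
  qed

  have legendre: "local_legendre t n j s = poly (lpol j) s" for j s
    unfolding local_legendre_def poly_lpol unfolding a_def b_def ..
  have coeff: "legendre_coeff t n j v = lcoef j v" for j v
    unfolding legendre_coeff_def lcoef_def legendre integral_open_interval_real [symmetric]
    unfolding a_def b_def ..
  have norm_y: "norm (y s) \<le> interval_norm t n y" if "s \<in> {a..b}" for s
    using interval_norm_upper [of t n y s] ab y_cont that by (simp add: a_def b_def)
  have norm_D: "norm (D (r + 1) s) \<le> interval_norm t n (D (r + 1))" if "s \<in> {a..b}" for s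
    using interval_norm_upper [of t n "D (r + 1)" s] ab D_top that by (simp add: a_def b_def del: nth_vector_deriv.simps)
  have "norm (\<iota> (U s) - u s + (local_legendre t n r s - local_legendre t n (r - 1) s) *\<^sub>R legendre_coeff t n r u)
      \<le> stability_const r * (norm (dG_left \<iota> t u0 U (n - 1) - u a)
        + (1 + radau_bound r) * ((b - a) ^ (r + 1) * interval_norm t n y))
      + radau_defect_bound r * ((b - a) ^ (r + 1) * interval_norm t n (D (r + 1)))" if "s \<in> {a<..<b}" for s
    using dG_step_error [OF A D D_top range h y_cont norm_y norm_D r P P' eq, of s] that
    by (simp add: legendre coeff UP D0)
  from interval_norm_least [of t n _, OF _ this] ab show ?thesis
    unfolding a_def b_def y_def [abs_def] D_def by simp
qed

theorem theorem4p5: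
  fixes \<iota> :: "'h::{real_inner,banach} \<Rightarrow>\<^sub>L 'l::{real_inner,banach}"
    and A :: "'h \<Rightarrow>\<^sub>L ('h \<Rightarrow>\<^sub>L real)"
    and r :: nat
  assumes "compact_dense_embedding \<iota>"
    and "self_adjoint_op A"
    and "strictly_positive_definite_op A"
    and "r \<ge> 1"
  shows "\<exists>C. \<forall>T N t f u0 u U n.
    time_levels T N t \<longrightarrow>
    is_solution \<iota> A T f u0 u \<longrightarrow>
    is_dG_solution \<iota> A r N t f u0 U \<longrightarrow>
    n \<in> {1..N} \<longrightarrow>
    (let I = {t (n - 1)..t n};
         ur = nth_vector_deriv r I u;
         ur1 = nth_vector_deriv (r + 1) I u;
         k = t n - t (n - 1)
     in
       C_times_on (r + 1) I u \<longrightarrow>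
       (\<forall>s\<in>I. ur s \<in> L_domain \<iota> A) \<longrightarrow>
       continuous_on I (\<lambda>s. L_valued_op \<iota> A (ur s)) \<longrightarrow>
       interval_norm t n
           (\<lambda>s. \<iota> (U s) - u s +
                (local_legendre t n r s - local_legendre t n (r - 1) s) *\<^sub>R legendre_coeff t n r u)
         \<le> C * norm (dG_left \<iota> t u0 U (n - 1) - u (t (n - 1)))
           + C * k ^ (r + 1) *
               (interval_norm t n (\<lambda>s. L_valued_op \<iota> A (ur s)) + interval_norm t n ur1))"
proof -
  define C where "C = stability_const r * (1 + radau_bound r) + radau_defect_bound r"
  have C: "stability_const r \<le> C" "stability_const r * (1 + radau_bound r) \<le> C" "radau_defect_bound r \<le> C"
    using stability_const_nonneg [of r] radau_bound_nonneg [of r] radau_defect_bound_nonneg [of r]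
    by (auto simp: C_def distrib_left)
  have combine: "stability_const r * (e + (1 + radau_bound r) * (K * Y)) + radau_defect_bound r * (K * B)
      \<le> C * e + C * K * (Y + B)" if "0 \<le> e" "0 \<le> K" "0 \<le> Y" "0 \<le> B" for e K Y B
  proof -
    have "stability_const r * e \<le> C * e"
      "stability_const r * (1 + radau_bound r) * (K * Y) \<le> C * (K * Y)"
      "radau_defect_bound r * (K * B) \<le> C * (K * B)"
      using that by (auto intro!: mult_right_mono C)
    then show ?thesis by (simp add: algebra_simps)
  qed
  show ?thesis
    unfolding Let_def
  proof (intro exI [of _ C] allI impI)
    fix T N and t :: "nat \<Rightarrow> real" and f u0 and u :: "real \<Rightarrow> 'l" and U n
    let ?I = "{t (n - 1)..t n}"
    let ?y = "\<lambda>s. L_valued_op \<iota> A (nth_vector_deriv r ?I u s)"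
    let ?k = "t n - t (n - 1)"
    assume levels: "time_levels T N t" and sol: "is_solution \<iota> A T f u0 u"
      and dG: "is_dG_solution \<iota> A r N t f u0 U" and n: "n \<in> {1..N}"
      and smooth: "C_times_on (r + 1) ?I u"
      and dom: "\<forall>s\<in>?I. nth_vector_deriv r ?I u s \<in> L_domain \<iota> A"
      and cont: "continuous_on ?I ?y"
    have inj: "inj (blinfun_apply \<iota>)" using assms(1) by (simp add: compact_dense_embedding_def)
    have tn: "t (n - 1) < t n" using levels n by (auto simp: time_levels_def)
    have top: "continuous_on ?I (nth_vector_deriv (r + 1) ?I u)"
      using smooth by (simp add: C_times_on_def del: nth_vector_deriv.simps)
    note dG_local_error [OF inj assms(3,4) levels sol dG n refl smooth bspec [OF dom] cont]
    also have "stability_const r * (norm (dG_left \<iota> t u0 U (n - 1) - u (t (n - 1)))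
        + (1 + radau_bound r) * (?k ^ (r + 1) * interval_norm t n ?y))
        + radau_defect_bound r * (?k ^ (r + 1) * interval_norm t n (nth_vector_deriv (r + 1) ?I u))
        \<le> C * norm (dG_left \<iota> t u0 U (n - 1) - u (t (n - 1)))
          + C * ?k ^ (r + 1) * (interval_norm t n ?y + interval_norm t n (nth_vector_deriv (r + 1) ?I u))"
      using tn by (intro combine interval_norm_nonneg cont top) auto
    finally show "interval_norm t n
        (\<lambda>s. \<iota> (U s) - u s + (local_legendre t n r s - local_legendre t n (r - 1) s) *\<^sub>R legendre_coeff t n r u)
        \<le> C * norm (dG_left \<iota> t u0 U (n - 1) - u (t (n - 1)))
          + C * ?k ^ (r + 1) * (interval_norm t n ?y + interval_norm t n (nth_vector_deriv (r + 1) ?I u))" .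
  qed
qed

end
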